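(* Let $\mathcal{H}$ be a complex Hilbert space and let $T, S \in \mathcal{B}(\mathcal{H})$. Then for all real $r \geq 1$ and $\lambda \geq 0$, $$w^{2r}(T^*S) \leq \frac{1}{2(\lambda+1)}\left\||T|^{2r} + |S|^{2r}\right\|w^r(T^*S) + \frac{\lambda}{4(\lambda+1)} \left\||T|^{4r} + |S|^{4r}\right\|+ \frac{\lambda}{2(\lambda +1)}\,w\left(|S|^{2r}|T|^{2r} \right).$$
   Context: $\mathcal{B}(\mathcal{H})$ is the $C^*$-algebra of all bounded linear operators on $\mathcal{H}$; $\|\cdot\|$ is the operator norm. For $T\in\mathcal{B}(\mathcal{H})$, $|T| = (T^*T)^{1/2}$; real powers of positive operators are taken by continuous functional calculus. The numerical radius is $w(T) = \sup_{\|x\|=1} |\langle Tx, x\rangle|$, and $w^p(T)$ denotes $(w(T))^p$. *)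

theory Defs
  imports "HOL-Analysis.Analysis"
begin

text \<open>
  Complex Hilbert spaces, as Banach spaces whose norm comes from a complex inner product
  that is linear in its first argument. The zero space is not excluded.
\<close>

class complex_hilbert_space = banach +
  fixes scaleC :: "complex \<Rightarrow> 'a \<Rightarrow> 'a"  (infixr \<open>*\<^sub>C\<close> 75)
    and cinner :: "'a \<Rightarrow> 'a \<Rightarrow> complex"
  assumes scaleC_add_right: "c *\<^sub>C (x + y) = c *\<^sub>C x + c *\<^sub>C y"
    and scaleC_add_left: "(c + d) *\<^sub>C x = c *\<^sub>C x + d *\<^sub>C x"
    and scaleC_scaleC: "c *\<^sub>C (d *\<^sub>C x) = (c * d) *\<^sub>C x"
    and scaleC_of_real: "complex_of_real a *\<^sub>C x = a *\<^sub>R x"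
    and cinner_add_left: "cinner (x + y) z = cinner x z + cinner y z"
    and cinner_scaleC_left: "cinner (c *\<^sub>C x) y = c * cinner x y"
    and cinner_commute: "cinner x y = cnj (cinner y x)"
    and cinner_self: "cinner x x = complex_of_real ((norm x)\<^sup>2)"

instantiation complex :: complex_hilbert_space
begin

definition "scaleC_complex (c :: complex) (x :: complex) = c * x"

definition "cinner_complex (x :: complex) (y :: complex) = x * cnj y"

instance
  by standard
    (simp_all add: scaleC_complex_def cinner_complex_def algebra_simps scaleR_conv_of_real
      complex_norm_square del: of_real_power)

end

text \<open>
  The library type of bounded operators contains all bounded real-linear maps; the algebra of
  bounded operators on the Hilbert space is its subset of complex-linear ones. The library norm
  on that type is the operator norm.
\<close>

definition bounded_operators :: "('a::complex_hilbert_space \<Rightarrow>\<^sub>L 'a) set" where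
  "bounded_operators = {T :: 'a \<Rightarrow>\<^sub>L 'a. \<forall>c x. T (c *\<^sub>C x) = c *\<^sub>C T x}"

definition hilbert_adjoint ::
    "('a::complex_hilbert_space \<Rightarrow>\<^sub>L 'a) \<Rightarrow> ('a \<Rightarrow>\<^sub>L 'a)" where
  "hilbert_adjoint T = (THE U :: 'a \<Rightarrow>\<^sub>L 'a. \<forall>x y. cinner (T x) y = cinner x (U y))"

text \<open>
  Inserting \<open>0\<close> only matters on the zero space, where there are no unit vectors and the supremum
  of the empty set of reals would be unspecified.
\<close>

definition numerical_radius :: "('a::complex_hilbert_space \<Rightarrow>\<^sub>L 'a) \<Rightarrow> real" where
  "numerical_radius T = Sup (insert 0 {cmod (cinner (T x) x) |x. norm x = 1})"

definition op_spectrum :: "('a::complex_hilbert_space \<Rightarrow>\<^sub>L 'a) \<Rightarrow> complex set" where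
  "op_spectrum A =
    {z. \<not> (\<exists>U :: 'a \<Rightarrow>\<^sub>L 'a. U \<in> bounded_operators \<and>
          (\<forall>x. U (A x - z *\<^sub>C x) = x \<and> A (U x) - z *\<^sub>C U x = x))}"

text \<open>
  \<open>\<Phi>\<close> is a unital star-homomorphism from the continuous functions on the spectrum of \<open>A\<close> to the
  bounded operators, mapping the identity function to \<open>A\<close>. A continuous function on the spectrum
  is represented by any of its extensions to the complex plane. For normal \<open>A\<close> such a
  homomorphism exists and is determined on these functions; off them \<open>\<Phi>\<close> is arbitrary, so
  \<open>cfc A f\<close> is meaningful only for \<open>f\<close> continuous on the spectrum.
\<close>

definition is_functional_calculus ::
    "('a::complex_hilbert_space \<Rightarrow>\<^sub>L 'a) \<Rightarrow> ((complex \<Rightarrow> complex) \<Rightarrow> ('a \<Rightarrow>\<^sub>L 'a)) \<Rightarrow> bool" where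
  "is_functional_calculus A \<Phi> \<longleftrightarrow>
    (\<forall>f. continuous_on (op_spectrum A) f \<longrightarrow>
      \<Phi> f \<in> bounded_operators \<and>
      (\<forall>c x. \<Phi> (\<lambda>z. c * f z) x = c *\<^sub>C \<Phi> f x) \<and>
      \<Phi> (\<lambda>z. cnj (f z)) = hilbert_adjoint (\<Phi> f) \<and>
      (\<forall>g. continuous_on (op_spectrum A) g \<longrightarrow>
        \<Phi> (\<lambda>z. f z + g z) = \<Phi> f + \<Phi> g \<and>
        \<Phi> (\<lambda>z. f z * g z) = \<Phi> f o\<^sub>L \<Phi> g \<and>
        ((\<forall>z\<in>op_spectrum A. f z = g z) \<longrightarrow> \<Phi> f = \<Phi> g))) \<and>
    \<Phi> (\<lambda>z. 1) = id_blinfun \<and>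
    \<Phi> (\<lambda>z. z) = A"

definition cfc ::
    "('a::complex_hilbert_space \<Rightarrow>\<^sub>L 'a) \<Rightarrow> (complex \<Rightarrow> complex) \<Rightarrow> ('a \<Rightarrow>\<^sub>L 'a)" where
  "cfc A f = (THE B. \<exists>\<Phi>. is_functional_calculus A \<Phi> \<and> \<Phi> f = B)"

text \<open>
  Real powers of a positive operator. Its spectrum consists of nonnegative reals, so taking the
  real part only changes the type. The exponent is meant to be positive, since
  \<^term>\<open>0 powr 0 = (0::real)\<close>.
\<close>

definition op_powr ::
    "('a::complex_hilbert_space \<Rightarrow>\<^sub>L 'a) \<Rightarrow> real \<Rightarrow> ('a \<Rightarrow>\<^sub>L 'a)"  (infixr \<open>powr\<^sub>o\<close> 80) where
  "A powr\<^sub>o p = cfc A (\<lambda>z. complex_of_real (Re z powr p))"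

definition op_abs :: "('a::complex_hilbert_space \<Rightarrow>\<^sub>L 'a) \<Rightarrow> ('a \<Rightarrow>\<^sub>L 'a)" where
  "op_abs T = (hilbert_adjoint T o\<^sub>L T) powr\<^sub>o (1/2)"

end

theory Submission
  imports Defs "HOL-Computational_Algebra.Fundamental_Theorem_Algebra"
begin

text \<open>
  For a unit vector \<open>x\<close> put \<open>a = \<bar>\<langle>T\<^sup>*Sx, x\<rangle>\<bar> \<le> \<parallel>Tx\<parallel> \<parallel>Sx\<parallel>\<close>, \<open>P = |T|\<^sup>2\<^sup>r\<close> and
  \<open>Q = |S|\<^sup>2\<^sup>r\<close>. Jensen's inequality \<open>\<parallel>Tx\<parallel>\<^sup>2\<^sup>r \<le> \<langle>Px, x\<rangle>\<close> gives
  \<open>a\<^sup>2\<^sup>r \<le> \<langle>Px, x\<rangle>\<langle>Qx, x\<rangle>\<close>. From this, \<open>a\<^sup>2\<^sup>r\<close> is estimated in two ways: by the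
  arithmetic-geometric mean inequality (on one of the two factors \<open>a\<^sup>r\<close>) and by Buzano's
  inequality. The claim is the convex combination of both estimates with weights \<open>1/(\<lambda>+1)\<close> and
  \<open>\<lambda>/(\<lambda>+1)\<close>.

  The functional calculus of a self-adjoint \<open>A\<close> is the uniform closure of polynomials in \<open>A\<close>. Its
  key estimate \<open>\<parallel>p(A)\<parallel> \<le> sup \<bar>p\<bar>\<close> over the spectrum needs no spectral radius formula: factoring
  polynomials over the complex numbers gives spectral mapping, and the infimum of the numerical
  range of a self-adjoint operator lies in its spectrum, so a polynomial that is nonnegative on the
  spectrum yields a positive operator.
\<close>

subsection \<open>Complex Hilbert spaces and adjoints\<close>

lemma cinner_add_right: "cinner x (y + z) = cinner x y + cinner x z"
  for x :: "'a::complex_hilbert_space"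
  by (metis cinner_add_left cinner_commute complex_cnj_add)

lemma cinner_scaleC_right: "cinner x (c *\<^sub>C y) = cnj c * cinner x y"
  for x :: "'a::complex_hilbert_space"
  by (metis cinner_commute cinner_scaleC_left complex_cnj_mult)

lemma norm_scaleC: "norm (c *\<^sub>C x) = cmod c * norm x"
  for x :: "'a::complex_hilbert_space"
proof -
  have "complex_of_real ((norm (c *\<^sub>C x))\<^sup>2) = c * cnj c * cinner x x"
    by (simp only: cinner_self[symmetric] cinner_scaleC_left cinner_scaleC_right mult_ac)
  also have "\<dots> = complex_of_real ((cmod c * norm x)\<^sup>2)"
    by (simp only: cinner_self complex_norm_square[symmetric] of_real_mult power_mult_distrib)
  finally have "(norm (c *\<^sub>C x))\<^sup>2 = (cmod c * norm x)\<^sup>2"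
    by (simp only: of_real_eq_iff)
  then show ?thesis
    by (simp add: power2_eq_iff_nonneg)
qed

lemma norm_add_square: "(norm (x + y))\<^sup>2 = (norm x)\<^sup>2 + 2 * Re (cinner x y) + (norm y)\<^sup>2"
  for x :: "'a::complex_hilbert_space"
proof -
  have "cinner (x + y) (x + y) = cinner x x + cinner x y + cnj (cinner x y) + cinner y y"
    by (simp add: cinner_add_left cinner_add_right flip: cinner_commute)
  from arg_cong[OF this, of Re] show ?thesis
    by (simp add: cinner_self del: of_real_power)
qed

text \<open>Cauchy-Schwarz, read off from the triangle inequality of the given norm: expanding both
  squares bounds the real part, and multiplying x by a phase makes the inner product real and
  nonnegative.\<close>

lemma cmod_cinner_le: "cmod (cinner x y) \<le> norm x * norm y"
  for x :: "'a::complex_hilbert_space"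
proof -
  have Re_le: "Re (cinner u y) \<le> norm u * norm y" for u :: 'a
  proof -
    have "(norm (u + y))\<^sup>2 \<le> (norm u + norm y)\<^sup>2"
      by (intro power_mono norm_triangle_ineq norm_ge_zero)
    then show ?thesis
      by (simp add: norm_add_square power2_sum)
  qed
  define c where "c = (if cinner x y = 0 then 1 else cnj (sgn (cinner x y)))"
  have "c * cinner x y = of_real (cmod (cinner x y))"
  proof (cases "cinner x y = 0")
    case False
    have "c * cinner x y = cinner x y * cnj (cinner x y) / of_real (cmod (cinner x y))"
      using False by (simp add: c_def sgn_div_norm scaleR_conv_of_real divide_inverse)
    also have "\<dots> = of_real (cmod (cinner x y))"
      using False by (simp add: power2_eq_square flip: complex_norm_square)
    finally show ?thesis .
  qed (simp add: c_def)
  then have "cmod (cinner x y) = Re (cinner (c *\<^sub>C x) y)"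
    by (simp add: cinner_scaleC_left)
  also have "\<dots> \<le> norm (c *\<^sub>C x) * norm y"
    by (rule Re_le)
  also have "cmod c = 1"
    by (simp add: c_def norm_sgn)
  then have "norm (c *\<^sub>C x) * norm y = norm x * norm y"
    by (simp add: norm_scaleC)
  finally show ?thesis .
qed

interpretation cinner: bounded_bilinear "cinner :: 'a::complex_hilbert_space \<Rightarrow> 'a \<Rightarrow> complex"
proof
  show "\<exists>K. \<forall>x y::'a. cmod (cinner x y) \<le> norm x * norm y * K"
    by (rule exI[of _ 1]) (simp add: cmod_cinner_le)
qed (simp_all add: cinner_add_left cinner_add_right cinner_scaleC_left cinner_scaleC_right
      scaleR_conv_of_real flip: scaleC_of_real)

interpretation scaleC: bounded_bilinear "scaleC :: complex \<Rightarrow> 'a::complex_hilbert_space \<Rightarrow> 'a"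
proof
  show "\<exists>K. \<forall>c (x::'a). norm (c *\<^sub>C x) \<le> norm c * norm x * K"
    by (rule exI[of _ 1]) (simp add: norm_scaleC)
qed (simp_all add: scaleC_add_left scaleC_add_right scaleC_scaleC scaleR_conv_of_real mult.commute
      flip: scaleC_of_real)

lemma scaleC_one [simp]: "1 *\<^sub>C x = x"
  for x :: "'a::complex_hilbert_space"
  using scaleC_of_real[of 1 x] by simp

lemma Re_cinner_self [simp]: "Re (cinner x x) = (norm x)\<^sup>2"
  for x :: "'a::complex_hilbert_space"
  by (simp add: cinner_self)

lemma Re_cinner_commute: "Re (cinner x y) = Re (cinner y x)"
  for x :: "'a::complex_hilbert_space"
  by (metis cinner_commute complex_cnj(1) complex.sel(1) complex_surj)

text \<open>The real part is itself a real inner product, so it separates points; the test vector is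
  \<open>y - z\<close>.\<close>

lemma Re_cinner_eqI:
  assumes "\<And>x. Re (cinner x y) = Re (cinner x z)"
  shows "y = (z :: 'a::complex_hilbert_space)"
proof -
  have "Re (cinner (y - z) (y - z)) = 0"
    using assms[of "y - z"] by (simp add: cinner.diff_right del: Re_cinner_self)
  then show ?thesis by simp
qed

text \<open>Replacing x by i x recovers the imaginary part. This lifts the real representation
  theorem below to complex inner products.\<close>

lemma cinner_eq_if_Re_eq:
  assumes T: "\<And>c x. T (c *\<^sub>C x) = c *\<^sub>C T x"
    and Re_eq: "\<And>x. Re (cinner (T x) y) = Re (cinner x z)"
  shows "cinner (T x) y = cinner x (z :: 'a::complex_hilbert_space)"
  using Re_eq[of x] Re_eq[of "\<i> *\<^sub>C x"] by (simp add: complex_eq_iff T cinner_scaleC_left)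

lemma bounded_bilinear_Re_cinner: "bounded_bilinear (\<lambda>x y :: 'a::complex_hilbert_space. Re (cinner x y))"
proof
  show "\<exists>K. \<forall>x y::'a. norm (Re (cinner x y)) \<le> norm x * norm y * K"
    by (rule exI[of _ 1]) (auto intro: order_trans[OF abs_Re_le_cmod cmod_cinner_le])
qed (simp_all add: cinner.add_left cinner.add_right cinner.scaleR_left cinner.scaleR_right)

text \<open>A reflection argument: \<open>2\<langle>a,e\<rangle>e - a\<close> has the same norm as \<open>a\<close>.\<close>

lemma buzano:
  fixes a b e :: "'a::complex_hilbert_space"
  assumes "norm e = 1"
  shows "cmod (cinner a e) * cmod (cinner e b) \<le> (norm a * norm b + cmod (cinner a b)) / 2"
proof -
  define u where "u = (2 * cinner a e) *\<^sub>C e - a"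
  have "cinner u u = cinner a a"
    using assms cinner_commute[of e a]
    by (simp add: u_def cinner.diff_left cinner.diff_right cinner_scaleC_left cinner_scaleC_right
        cinner_self[of e] algebra_simps)
  then have "norm u = norm a"
    by (metis Re_cinner_self norm_ge_zero power2_eq_iff_nonneg)
  then have "cmod (cinner u b) \<le> norm a * norm b"
    using cmod_cinner_le[of u b] by simp
  moreover have "2 * (cinner a e * cinner e b) = cinner u b + cinner a b"
    by (simp add: u_def cinner.diff_left cinner_scaleC_left)
  then have "2 * (cmod (cinner a e) * cmod (cinner e b)) \<le> cmod (cinner u b) + cmod (cinner a b)"
    by (metis norm_mult norm_numeral norm_triangle_ineq)
  ultimately show ?thesis by simp
qed

section \<open>Minimisation of coercive quadratic functionals\<close>

text \<open>The solution minimises \<open>a x x - 2 f x\<close>; minimising sequences are Cauchy by the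
  parallelogram law.\<close>

lemma symmetric_lax_milgram:
  fixes a :: "'a::banach \<Rightarrow> 'a \<Rightarrow> real" and f :: "'a \<Rightarrow> real"
  assumes a: "bounded_bilinear a" and sym: "\<And>x y. a x y = a y x"
    and c: "c > 0" "\<And>x. a x x \<ge> c * (norm x)\<^sup>2" and f: "bounded_linear f"
  obtains u where "\<And>x. a x u = f x"
proof -
  interpret a: bounded_bilinear a by fact
  interpret f: bounded_linear f by fact
  define J where "J x = a x x - 2 * f x" for x
  obtain K where K: "\<And>x. norm (f x) \<le> norm x * K"
    using f.bounded by blast
  \<comment> \<open>Completing the square in \<open>norm x\<close> shows that the functional is
    bounded below.\<close>
  have J_lower: "- (K\<^sup>2 / c) \<le> J x" for x
  proof -
    have "0 \<le> (c * norm x - K)\<^sup>2 / c"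
      using c by simp
    also have "\<dots> = c * (norm x)\<^sup>2 - 2 * (norm x * K) + K\<^sup>2 / c"
      using c by (simp add: power2_eq_square field_simps)
    finally show ?thesis
      using c(2)[of x] K[of x] unfolding J_def by (simp add: abs_le_iff)
  qed
  define d where "d = (INF x. J x)"
  have bdd: "bdd_below (range J)"
    using J_lower by (auto simp: bdd_below_def)
  have d_le: "d \<le> J x" for x
    unfolding d_def by (intro cINF_lower bdd) auto
  have "\<exists>x. J x < d + 1 / real (Suc n)" for n
  proof -
    have "Inf (range J) < d + 1 / real (Suc n)" by (simp add: d_def)
    then show ?thesis
      using cInf_lessD[of "range J"] by blast
  qed
  then obtain X where X: "\<And>n. J (X n) < d + 1 / real (Suc n)"
    by metis
  have par: "J x + J y = 2 * J ((1/2) *\<^sub>R (x + y)) + a (x - y) (x - y) / 2" for x y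
    by (simp add: J_def a.add_left a.add_right a.diff_left a.diff_right a.scaleR_left
        a.scaleR_right f.add f.scaleR sym[of y x] field_simps)
  \<comment> \<open>The midpoint has value at least \<open>d\<close>, so in \<open>par\<close> half
    the form on the difference is at most the total excess of both values over
    \<open>d\<close>.\<close>
  have near: "c * (norm (X m - X n))\<^sup>2 \<le> 2 * (1 / real (Suc m) + 1 / real (Suc n))" for m n
  proof -
    have "c * (norm (X m - X n))\<^sup>2 \<le> a (X m - X n) (X m - X n)"
      by (rule c)
    also have "\<dots> \<le> 2 * (1 / real (Suc m) + 1 / real (Suc n))"
      using par[of "X m" "X n"] add_strict_mono[OF X[of m] X[of n]]
        d_le[of "(1/2) *\<^sub>R (X m + X n)"] by argo
    finally show ?thesis .
  qed
  have "Cauchy X"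
  proof (rule metric_CauchyI)
    fix e :: real
    assume e: "0 < e"
    then obtain N where N: "inverse (real (Suc N)) < c * e\<^sup>2 / 4"
      using reals_Archimedean[of "c * e\<^sup>2 / 4"] c(1) by auto
    have "dist (X m) (X n) < e" if "N \<le> m" "N \<le> n" for m n
    proof -
      have "1 / real (Suc m) \<le> inverse (real (Suc N))" "1 / real (Suc n) \<le> inverse (real (Suc N))"
        using that by (auto simp: field_simps)
      then have "c * (norm (X m - X n))\<^sup>2 < c * e\<^sup>2"
        using near[of m n] N by argo
      then have "(norm (X m - X n))\<^sup>2 < e\<^sup>2"
        using c(1) by simp
      then show ?thesis
        using e by (simp add: dist_norm power2_less_imp_less)
    qed
    then show "\<exists>M. \<forall>m\<ge>M. \<forall>n\<ge>M. dist (X m) (X n) < e" by blast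
  qed
  then obtain u where u: "X \<longlonglongrightarrow> u"
    using Cauchy_convergent_iff convergent_def by blast
  have "(\<lambda>n. J (X n)) \<longlonglongrightarrow> J u"
    unfolding J_def by (intro tendsto_intros a.tendsto f.tendsto u)
  moreover have "(\<lambda>n. d + 1 / real (Suc n)) \<longlonglongrightarrow> d + 0"
    by (intro tendsto_intros) (use LIMSEQ_inverse_real_of_nat in \<open>simp add: inverse_eq_divide\<close>)
  ultimately have "J u \<le> d + 0"
    by (rule LIMSEQ_le) (use X less_imp_le in blast)
  then have Ju: "J u \<le> J x" for x
    using d_le[of x] by simp
  have "a x u = f x" for x
  proof (rule ccontr)
    define b where "b = a x u - f x"
    assume "a x u \<noteq> f x"
    then have b: "b \<noteq> 0" by (simp add: b_def)
    \<comment> \<open>This \<open>t\<close> minimises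
      \<open>t\<^sup>2 * (1 + a x x) + 2 * t * b\<close>, an upper bound for the change of
      \<open>J\<close>. The summand 1 keeps the denominator positive when \<open>a x x\<close> is
      0.\<close>
    define t where "t = - b / (1 + a x x)"
    have axx: "0 \<le> a x x"
      using c(2)[of x] c(1) by (meson dual_order.trans less_imp_le mult_nonneg_nonneg zero_le_power2)
    have "J (u + t *\<^sub>R x) = J u + t\<^sup>2 * a x x + 2 * t * b"
      by (simp add: J_def b_def a.add_left a.add_right a.scaleR_left a.scaleR_right f.add f.scaleR
          sym[of u x] power2_eq_square algebra_simps)
    then have "0 \<le> t\<^sup>2 * a x x + 2 * t * b"
      using Ju[of "u + t *\<^sub>R x"] by simp
    also have "\<dots> \<le> t\<^sup>2 * (1 + a x x) + 2 * t * b" by (simp add: distrib_left)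
    also have "\<dots> = - b\<^sup>2 / (1 + a x x)"
      using axx by (simp add: t_def power2_eq_square divide_simps)
    also have "\<dots> < 0"
      using axx b by (simp add: divide_neg_pos)
    finally show False by simp
  qed
  then show ?thesis by (rule that)
qed

section \<open>Complex-linear operators and existence of adjoints\<close>

lemma bounded_operators_scaleC: "T \<in> bounded_operators \<Longrightarrow> T (c *\<^sub>C x) = c *\<^sub>C T x"
  by (simp add: bounded_operators_def)

lemma bounded_operators_id [simp]: "id_blinfun \<in> bounded_operators"
  by (simp add: bounded_operators_def)

lemma bounded_operators_zero [simp]: "0 \<in> bounded_operators"
  by (simp add: bounded_operators_def scaleC.zero_right)

lemma bounded_operators_compose [simp]:
  "S \<in> bounded_operators \<Longrightarrow> T \<in> bounded_operators \<Longrightarrow> S o\<^sub>L T \<in> bounded_operators"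
  by (simp add: bounded_operators_def)

lemma bounded_operators_add [simp]:
  "S \<in> bounded_operators \<Longrightarrow> T \<in> bounded_operators \<Longrightarrow> S + T \<in> bounded_operators"
  by (simp add: bounded_operators_def blinfun.add_left scaleC.add_right)

lemma bounded_operators_diff [simp]:
  "S \<in> bounded_operators \<Longrightarrow> T \<in> bounded_operators \<Longrightarrow> S - T \<in> bounded_operators"
  by (simp add: bounded_operators_def blinfun.diff_left scaleC.diff_right)

text \<open>Complex multiples of the identity, so that shifts by a spectral parameter and complex
  coefficients become operator arithmetic.\<close>

lift_definition scalar_op :: "complex \<Rightarrow> 'a::complex_hilbert_space \<Rightarrow>\<^sub>L 'a" is "(*\<^sub>C)"
  by (rule scaleC.bounded_linear_right)

declare scalar_op.rep_eq [simp]

lemma bounded_operators_scalar [simp]: "scalar_op c \<in> bounded_operators"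
  by (simp add: bounded_operators_def scaleC_scaleC mult.commute)

lemma hilbert_adjoint_eqI:
  fixes T U :: "'a::complex_hilbert_space \<Rightarrow>\<^sub>L 'a"
  assumes "\<And>x y. cinner (T x) y = cinner x (U y)"
  shows "hilbert_adjoint T = U"
  unfolding hilbert_adjoint_def
proof (rule the_equality)
  show "V = U" if V: "\<forall>x y. cinner (T x) y = cinner x (V y)" for V :: "'a \<Rightarrow>\<^sub>L 'a"
  proof (rule blinfun_eqI)
    show "V y = U y" for y
      by (rule Re_cinner_eqI) (metis V assms)
  qed
qed (use assms in blast)

text \<open>Riesz representation: \<open>symmetric_lax_milgram\<close>, applied to the real part of
  the inner product with coercivity constant 1, represents the functional sending x to the real part
  of \<open>cinner (T x) y\<close>. The representing vectors form a bounded linear map in y, which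
  must be the adjoint.\<close>

lemma cinner_hilbert_adjoint_right:
  fixes T :: "'a::complex_hilbert_space \<Rightarrow>\<^sub>L 'a"
  assumes T: "T \<in> bounded_operators"
  shows "cinner (T x) y = cinner x (hilbert_adjoint T y)"
proof -
  have "\<exists>u. \<forall>x. cinner (T x) y = cinner x u" for y
  proof -
    have "bounded_bilinear (\<lambda>x y :: 'a. Re (cinner x y))"
      by (rule bounded_bilinear_Re_cinner)
    moreover have "bounded_linear (\<lambda>x. Re (cinner (T x) y))"
      by (intro bounded_linear_compose[OF bounded_linear_Re]
          bounded_linear_compose[OF cinner.bounded_linear_left] blinfun.bounded_linear_right)
    ultimately obtain u where "\<And>x. Re (cinner x u) = Re (cinner (T x) y)"
      using symmetric_lax_milgram[of "\<lambda>x y. Re (cinner x y)" 1 "\<lambda>x. Re (cinner (T x) y)"]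
      by (auto simp: Re_cinner_commute)
    then have "cinner (T x) y = cinner x u" for x
      using bounded_operators_scaleC[OF T] by (intro cinner_eq_if_Re_eq) auto
    then show ?thesis by blast
  qed
  then obtain U where U: "\<And>x y. cinner (T x) y = cinner x (U y)"
    by metis
  have "bounded_linear U"
  proof (rule bounded_linear_intro)
    show "U (x + y) = U x + U y" for x y
      by (rule Re_cinner_eqI) (simp add: cinner.add_right flip: U)
    show "U (r *\<^sub>R x) = r *\<^sub>R U x" for r x
      by (rule Re_cinner_eqI) (simp add: cinner.scaleR_right flip: U)
    \<comment> \<open>Testing with \<open>U x\<close> itself bounds its squared norm by
      \<open>norm T * norm (U x) * norm x\<close>, and one factor cancels.\<close>
    show "norm (U x) \<le> norm x * norm T" for x
    proof (cases "U x = 0")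
      case False
      have "(norm (U x))\<^sup>2 = Re (cinner (T (U x)) x)" by (simp add: U)
      also have "\<dots> \<le> norm (T (U x)) * norm x"
        using complex_Re_le_cmod cmod_cinner_le order_trans by blast
      also have "\<dots> \<le> norm T * norm (U x) * norm x"
        by (intro mult_right_mono norm_blinfun norm_ge_zero)
      finally show ?thesis
        using False by (simp add: power2_eq_square mult_ac)
    qed simp
  qed
  then have "hilbert_adjoint T = Blinfun U"
    using U by (intro hilbert_adjoint_eqI) (simp add: bounded_linear_Blinfun_apply)
  then show ?thesis
    using U \<open>bounded_linear U\<close> by (simp add: bounded_linear_Blinfun_apply)
qed

lemma hilbert_adjoint_bounded_operators [simp]:
  assumes "T \<in> bounded_operators"
  shows "hilbert_adjoint T \<in> bounded_operators"
proof -
  have "hilbert_adjoint T (c *\<^sub>C x) = c *\<^sub>C hilbert_adjoint T x" for c x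
    by (rule Re_cinner_eqI)
      (simp add: cinner_scaleC_right flip: cinner_hilbert_adjoint_right[OF assms])
  then show ?thesis by (simp add: bounded_operators_def)
qed

subsection \<open>Spectra and polynomials of self-adjoint operators\<close>

text \<open>Symmetry of the form is used instead of an equation with \<open>hilbert_adjoint\<close>,
  which avoids the definite description.\<close>

definition selfadjoint :: "('a::complex_hilbert_space \<Rightarrow>\<^sub>L 'a) \<Rightarrow> bool" where
  "selfadjoint A \<longleftrightarrow> A \<in> bounded_operators \<and> (\<forall>x y. cinner (A x) y = cinner x (A y))"

definition invertible_op :: "('a::complex_hilbert_space \<Rightarrow>\<^sub>L 'a) \<Rightarrow> bool" where
  "invertible_op B \<longleftrightarrow> (\<exists>U\<in>bounded_operators. \<forall>x. U (B x) = x \<and> B (U x) = x)"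

lemma op_spectrum_iff: "z \<in> op_spectrum A \<longleftrightarrow> \<not> invertible_op (A - scalar_op z)"
  by (auto simp: op_spectrum_def invertible_op_def blinfun.diff_left)

lemma selfadjointD:
  assumes "selfadjoint A"
  shows "A \<in> bounded_operators" "cinner (A x) y = cinner x (A y)"
  using assms by (auto simp: selfadjoint_def)

text \<open>The lower bound yields injectivity and at the same time bounds the set-theoretic inverse
  by \<open>1 / c\<close>; linearity of the inverse follows from injectivity.\<close>

lemma invertible_op_if_bounded_below:
  fixes B :: "'a::complex_hilbert_space \<Rightarrow>\<^sub>L 'a"
  assumes B: "B \<in> bounded_operators" and c: "c > 0" "\<And>x. c * norm x \<le> norm (B x)"
    and surj: "\<And>y. \<exists>x. B x = y"
  shows "invertible_op B"
proof -
  obtain U where BU: "\<And>y. B (U y) = y"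
    using surj by metis
  have inj: "x = y" if "B x = B y" for x y
    using c(1) c(2)[of "x - y"] that by (simp add: blinfun.diff_right mult_le_0_iff)
  have UB: "U (B x) = x" for x
    by (rule inj) (rule BU)
  have "bounded_linear U"
  proof (rule bounded_linear_intro)
    show "U (x + y) = U x + U y" for x y
      by (rule inj) (simp add: BU blinfun.add_right)
    show "U (r *\<^sub>R x) = r *\<^sub>R U x" for r x
      by (rule inj) (simp add: BU blinfun.scaleR_right)
    show "norm (U x) \<le> norm x * (1 / c)" for x
      using c(1) c(2)[of "U x"] by (simp add: BU field_simps)
  qed
  moreover have "U (z *\<^sub>C x) = z *\<^sub>C U x" for z x
    by (rule inj) (simp add: BU bounded_operators_scaleC[OF B])
  ultimately show ?thesis
    unfolding invertible_op_def
    by (intro bexI[of _ "Blinfun U"])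
      (auto simp: bounded_operators_def bounded_linear_Blinfun_apply UB BU)
qed

text \<open>Surjectivity is the issue. The lower bound for \<open>E\<close> makes the form
  \<open>Re (cinner (E u) (E v))\<close> coercive, so some u represents pairing with y; then
  \<open>D (E u) = y\<close>, because \<open>D\<close> is adjoint to \<open>E\<close>.\<close>

lemma invertible_op_if_adjoint_bounded_below:
  fixes D E :: "'a::complex_hilbert_space \<Rightarrow>\<^sub>L 'a"
  assumes D: "D \<in> bounded_operators"
    and adj: "\<And>x y. cinner (D x) y = cinner x (E y)"
    and c: "c > 0" "\<And>x. c * norm x \<le> norm (D x)" "\<And>x. c * norm x \<le> norm (E x)"
  shows "invertible_op D"
proof (rule invertible_op_if_bounded_below[OF D c(1,2)])
  fix y :: 'a
  define a where "a u v = Re (cinner (E u) (E v))" for u v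
  have "bounded_bilinear a"
    unfolding a_def
    by (rule bounded_bilinear.comp[OF bounded_bilinear_Re_cinner]) (rule blinfun.bounded_linear_right)+
  moreover have "a u v = a v u" for u v
    by (simp add: a_def Re_cinner_commute)
  moreover have "c\<^sup>2 > 0"
    using c(1) by simp
  moreover have "c\<^sup>2 * (norm u)\<^sup>2 \<le> a u u" for u
    using power_mono[OF c(3)[of u], of 2] c(1) by (simp add: a_def power_mult_distrib)
  moreover have "bounded_linear (\<lambda>x. Re (cinner x y))"
    by (rule bounded_bilinear.bounded_linear_left[OF bounded_bilinear_Re_cinner])
  ultimately obtain u where u: "\<And>x. a x u = Re (cinner x y)"
    by (rule symmetric_lax_milgram) blast
  have "D (E u) = y"
  proof (rule Re_cinner_eqI)
    show "Re (cinner x (D (E u))) = Re (cinner x y)" for x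
      using u[of x] by (simp add: a_def adj Re_cinner_commute[of x])
        (simp add: Re_cinner_commute)
  qed
  then show "\<exists>x. D x = y" by blast
qed

section \<open>Numerical range and location of the spectrum\<close>

lemma norm_ge_if_form_ge:
  fixes y :: "'a::complex_hilbert_space"
  assumes "c * (norm x)\<^sup>2 \<le> cmod (cinner y x)"
  shows "c * norm x \<le> norm y"
proof (cases "x = 0")
  case False
  have "(c * norm x) * norm x \<le> norm y * norm x"
    using order_trans[OF assms cmod_cinner_le] by (simp add: power2_eq_square mult_ac)
  then show ?thesis
    using False by simp
qed simp

lemma cinner_diff_scalar_op:
  assumes "selfadjoint A"
  shows "cinner ((A - scalar_op z) x) y = cinner x ((A - scalar_op (cnj z)) y)"
  using selfadjointD(2)[OF assms]
  by (simp add: blinfun.diff_left cinner.diff_left cinner.diff_right cinner_scaleC_left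
      cinner_scaleC_right)

text \<open>The forms of \<open>A - z\<close> and of its adjoint are conjugate on the diagonal, so
  one lower bound serves both and the preceding criterion applies. The three localisations of the
  spectrum below take for \<open>c\<close> the numbers |Im z|, -Re z and |z| - ||A||.\<close>

lemma not_in_spectrum_if_form_ge:
  assumes A: "selfadjoint A" and c: "c > 0"
    and ge: "\<And>x. c * (norm x)\<^sup>2 \<le> cmod (cinner (A x) x - z * cinner x x)"
  shows "z \<notin> op_spectrum A"
proof -
  have form: "cinner ((A - scalar_op z) x) x = cinner (A x) x - z * cinner x x" for x
    by (simp add: blinfun.diff_left cinner.diff_left cinner_scaleC_left)
  have D: "c * norm x \<le> norm ((A - scalar_op z) x)" for x
    by (rule norm_ge_if_form_ge) (use ge[of x] form[of x] in simp)
  have E: "c * norm x \<le> norm ((A - scalar_op (cnj z)) x)" for x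
  proof (rule norm_ge_if_form_ge)
    have "cmod (cinner ((A - scalar_op (cnj z)) x) x) = cmod (cinner ((A - scalar_op z) x) x)"
      using cinner_diff_scalar_op[OF A, of z x x] by (metis cinner_commute complex_mod_cnj)
    then show "c * (norm x)\<^sup>2 \<le> cmod (cinner ((A - scalar_op (cnj z)) x) x)"
      using ge[of x] form[of x] by simp
  qed
  have "invertible_op (A - scalar_op z)"
    using A by (intro invertible_op_if_adjoint_bounded_below[OF _ cinner_diff_scalar_op c D E])
      (auto simp: selfadjoint_def)
  then show ?thesis by (simp add: op_spectrum_iff)
qed

lemma selfadjoint_form_real:
  assumes "selfadjoint A"
  shows "Im (cinner (A x) x) = 0"
  by (metis assms selfadjointD(2) cinner_commute complex_cnj_cancel_iff Reals_cnj_iff complex_is_Real_iff)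

lemma selfadjoint_spectrum_real:
  assumes "selfadjoint A" "z \<in> op_spectrum A"
  shows "Im z = 0"
proof (rule ccontr)
  assume z: "Im z \<noteq> 0"
  have "\<bar>Im z\<bar> * (norm x)\<^sup>2 \<le> cmod (cinner (A x) x - z * cinner x x)" for x
    using abs_Im_le_cmod[of "cinner (A x) x - z * cinner x x"]
    by (simp add: selfadjoint_form_real[OF assms(1)] cinner_self abs_mult)
  then show False
    using not_in_spectrum_if_form_ge[OF assms(1), of "\<bar>Im z\<bar>" z] z assms(2) by simp
qed

lemma positive_spectrum_nonneg:
  assumes A: "selfadjoint A" and pos: "\<And>x. 0 \<le> Re (cinner (A x) x)" and z: "z \<in> op_spectrum A"
  shows "0 \<le> Re z"
proof (rule ccontr)
  assume neg: "\<not> 0 \<le> Re z"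
  have "- Re z * (norm x)\<^sup>2 \<le> cmod (cinner (A x) x - z * cinner x x)" for x
    using complex_Re_le_cmod[of "cinner (A x) x - z * cinner x x"] pos[of x]
    by (simp add: cinner_self)
  then show False
    using not_in_spectrum_if_form_ge[OF A, of "- Re z" z] neg z by simp
qed

lemma spectrum_bounded:
  assumes A: "selfadjoint A" and z: "z \<in> op_spectrum A"
  shows "cmod z \<le> norm A"
proof (rule ccontr)
  assume *: "\<not> cmod z \<le> norm A"
  have "(cmod z - norm A) * (norm x)\<^sup>2 \<le> cmod (cinner (A x) x - z * cinner x x)" for x
  proof -
    have "cmod (cinner (A x) x) \<le> norm (A x) * norm x"
      by (rule cmod_cinner_le)
    also have "\<dots> \<le> norm A * norm x * norm x"
      by (intro mult_right_mono norm_blinfun norm_ge_zero)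
    finally have "cmod (cinner (A x) x) \<le> norm A * (norm x)\<^sup>2"
      by (simp add: power2_eq_square mult_ac)
    moreover have "cmod (z * cinner x x) = cmod z * (norm x)\<^sup>2"
      by (simp add: cinner_self norm_mult norm_power)
    moreover have "cmod (z * cinner x x) - cmod (cinner (A x) x) \<le> cmod (cinner (A x) x - z * cinner x x)"
      by (metis norm_minus_commute norm_triangle_ineq2)
    ultimately show ?thesis by (simp add: algebra_simps)
  qed
  then show False
    using not_in_spectrum_if_form_ge[OF A, of "cmod z - norm A" z] * z by simp
qed

lemma invertible_op_bounded_below:
  fixes B :: "'a::complex_hilbert_space \<Rightarrow>\<^sub>L 'a"
  assumes "invertible_op B"
  obtains c where "c > 0" "\<And>x. c * norm x \<le> norm (B x)"
proof -
  obtain U :: "'a \<Rightarrow>\<^sub>L 'a" where U: "\<And>x. U (B x) = x"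
    using assms by (auto simp: invertible_op_def)
  show ?thesis
  proof (rule that)
    \<comment> \<open>The summand 1 keeps the denominator positive on the zero space, where the
      inverse has norm 0.\<close>
    show "0 < 1 / (norm U + 1)" by (simp add: add_nonneg_pos)
    show "1 / (norm U + 1) * norm x \<le> norm (B x)" for x
    proof -
      have "norm x \<le> norm U * norm (B x)"
        using norm_blinfun[of U "B x"] by (simp add: U)
      also have "\<dots> \<le> (norm U + 1) * norm (B x)"
        by (simp add: distrib_right)
      finally show ?thesis
        by (simp add: divide_simps add_nonneg_pos mult.commute)
    qed
  qed
qed

text \<open>For real s the operator \<open>A - s\<close> is its own adjoint, so a lower bound alone
  makes it invertible. A lower bound c at t leaves c/2 whenever |s - t| < c/2, hence the complement
  is open. The set is taken in the reals because real polynomial approximation will be applied on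
  it.\<close>

lemma compact_real_spectrum:
  assumes A: "selfadjoint A"
  shows "compact {t. complex_of_real t \<in> op_spectrum A}"
proof -
  let ?S = "{t. complex_of_real t \<in> op_spectrum A}"
  have "open (- ?S)"
  proof (rule openI)
    fix t assume "t \<in> - ?S"
    then have "invertible_op (A - scalar_op (of_real t))"
      by (simp add: op_spectrum_iff)
    then obtain c where c: "c > 0" "\<And>x. c * norm x \<le> norm ((A - scalar_op (of_real t)) x)"
      by (rule invertible_op_bounded_below) blast
    have "s \<notin> ?S" if s: "dist t s < c / 2" for s
    proof -
      have below: "c / 2 * norm x \<le> norm ((A - scalar_op (of_real s)) x)" for x
      proof -
        have "(A - scalar_op (of_real t)) x = (A - scalar_op (of_real s)) x + (s - t) *\<^sub>R x"
          by (simp add: blinfun.diff_left scaleC_of_real algebra_simps)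
        then have "c * norm x \<le> norm ((A - scalar_op (of_real s)) x) + \<bar>s - t\<bar> * norm x"
          using c(2)[of x] norm_triangle_ineq[of "(A - scalar_op (of_real s)) x" "(s - t) *\<^sub>R x"]
          by simp
        moreover have "\<bar>s - t\<bar> * norm x \<le> c / 2 * norm x"
          using s by (intro mult_right_mono) (auto simp: dist_real_def abs_minus_commute)
        ultimately show ?thesis by (simp add: field_simps)
      qed
      have "invertible_op (A - scalar_op (of_real s))"
        using c(1) A below cinner_diff_scalar_op[OF A, of "of_real s"]
        by (intro invertible_op_if_adjoint_bounded_below[of _ "A - scalar_op (of_real s)" "c / 2"])
          (auto simp: selfadjoint_def)
      then show ?thesis by (simp add: op_spectrum_iff)
    qed
    then show "\<exists>T>0. ball t T \<subseteq> - ?S"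
      using c(1) by (intro exI[of _ "c / 2"]) auto
  qed
  moreover have "bounded ?S"
    unfolding bounded_iff using spectrum_bounded[OF A] by (metis mem_Collect_eq norm_of_real real_norm_def)
  ultimately show ?thesis
    by (simp add: compact_eq_bounded_closed closed_def)
qed

text \<open>The point found is the infimum of the numerical range.\<close>

lemma spectrum_le_form:
  assumes A: "selfadjoint A" and "x \<noteq> 0"
  obtains m where "complex_of_real m \<in> op_spectrum A" "m * (norm x)\<^sup>2 \<le> Re (cinner (A x) x)"
proof -
  define V where "V = {Re (cinner (A y) y) |y. norm y = 1}"
  define m where "m = Inf V"
  have "V \<noteq> {}"
    using \<open>x \<noteq> 0\<close> by (auto simp: V_def intro!: exI[of _ "(1 / norm x) *\<^sub>R x"])
  have bdd: "bdd_below V"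
  proof (rule bdd_belowI)
    fix v assume "v \<in> V"
    then obtain y where y: "norm y = 1" "v = Re (cinner (A y) y)"
      by (auto simp: V_def)
    have "\<bar>v\<bar> \<le> norm (A y) * norm y"
      using order_trans[OF abs_Re_le_cmod cmod_cinner_le] by (simp add: y(2))
    also have "\<dots> \<le> norm A"
      using norm_blinfun[of A y] y(1) by simp
    finally show "- norm A \<le> v" by simp
  qed
  have m_le: "m * (norm y)\<^sup>2 \<le> Re (cinner (A y) y)" for y
  proof (cases "y = 0")
    case False
    have "Re (cinner (A ((1 / norm y) *\<^sub>R y)) ((1 / norm y) *\<^sub>R y)) \<in> V"
      using False by (auto simp: V_def intro!: exI[of _ "(1 / norm y) *\<^sub>R y"])
    then have "m \<le> Re (cinner (A ((1 / norm y) *\<^sub>R y)) ((1 / norm y) *\<^sub>R y))"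
      unfolding m_def by (rule cInf_lower[OF _ bdd])
    also have "\<dots> = Re (cinner (A y) y) / (norm y)\<^sup>2"
      by (simp add: blinfun.scaleR_right cinner.scaleR_left cinner.scaleR_right power2_eq_square)
    finally show ?thesis
      using False by (simp add: pos_le_divide_eq)
  qed (simp add: blinfun.zero_right)
  define B where "B = A - scalar_op (of_real m)"
  have B: "cinner (B y) w = cinner y (B w)" for y w
    using cinner_diff_scalar_op[OF A, of "of_real m"] by (simp add: B_def)
  have form_B: "Re (cinner (B y) y) = Re (cinner (A y) y) - m * (norm y)\<^sup>2" for y
    by (simp add: B_def blinfun.diff_left cinner.diff_left cinner_scaleC_left cinner_self)
  \<comment> \<open>A strictly positive upper bound for the norm, also when \<open>B\<close> is
    0.\<close>
  define K where "K = norm B + 1"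
  have K: "K > 0" by (simp add: K_def add_nonneg_pos)
  \<comment> \<open>A nonnegative form controls the norm of \<open>B y\<close>: the form is
    evaluated at y moved by \<open>1 / K\<close> against its gradient direction
    \<open>B y\<close>.\<close>
  have norm_B_le: "(norm (B y))\<^sup>2 \<le> K * Re (cinner (B y) y)" for y
  proof -
    define w where "w = y - (1 / K) *\<^sub>R B y"
    have "0 \<le> Re (cinner (B w) w)"
      using m_le[of w] by (simp add: form_B)
    also have "Re (cinner (B w) w)
        = Re (cinner (B y) y) - 2 / K * (norm (B y))\<^sup>2 + (1 / K)\<^sup>2 * Re (cinner (B (B y)) (B y))"
      by (simp add: w_def blinfun.diff_right blinfun.scaleR_right cinner.diff_left cinner.diff_right
          cinner.scaleR_left cinner.scaleR_right B[of "B y" y] power2_eq_square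
          diff_divide_distrib)
    also have "Re (cinner (B (B y)) (B y)) \<le> K * (norm (B y))\<^sup>2"
    proof -
      have "Re (cinner (B (B y)) (B y)) \<le> norm (B (B y)) * norm (B y)"
        by (rule order_trans[OF complex_Re_le_cmod cmod_cinner_le])
      also have "\<dots> \<le> norm B * norm (B y) * norm (B y)"
        by (intro mult_right_mono norm_blinfun norm_ge_zero)
      also have "\<dots> \<le> K * (norm (B y))\<^sup>2"
        by (simp add: K_def power2_eq_square distrib_right)
      finally show ?thesis .
    qed
    finally have "0 \<le> Re (cinner (B y) y) - 2 / K * (norm (B y))\<^sup>2 + (1 / K)\<^sup>2 * (K * (norm (B y))\<^sup>2)"
      by (simp add: mult_left_mono)
    also have "(1 / K)\<^sup>2 * (K * (norm (B y))\<^sup>2) = 1 / K * (norm (B y))\<^sup>2"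
      using K by (simp add: power2_eq_square)
    finally have "(norm (B y))\<^sup>2 / K \<le> Re (cinner (B y) y)"
      by (simp add: field_simps)
    then show ?thesis
      using K by (simp add: field_simps)
  qed
  have "of_real m \<in> op_spectrum A"
  proof (rule ccontr)
    assume "of_real m \<notin> op_spectrum A"
    then have "invertible_op B" by (simp add: op_spectrum_iff B_def)
    then obtain c where c: "c > 0" "\<And>y. c * norm y \<le> norm (B y)"
      by (rule invertible_op_bounded_below) blast
    \<comment> \<open>If \<open>B\<close> were bounded below by c, all of \<open>V\<close> would lie
      at least \<open>c\<^sup>2 / K\<close> above its infimum m.\<close>
    have "m + c\<^sup>2 / K \<le> v" if "v \<in> V" for v
    proof -
      obtain y where y: "norm y = 1" "v = Re (cinner (A y) y)"
        using \<open>v \<in> V\<close> by (auto simp: V_def)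
      have "c\<^sup>2 \<le> (norm (B y))\<^sup>2"
        using c(1) c(2)[of y] y(1) by (simp add: power_mono)
      also have "\<dots> \<le> K * (v - m)"
        using norm_B_le[of y] y by (simp add: form_B)
      finally show ?thesis
        using K by (simp add: field_simps)
    qed
    then have "m + c\<^sup>2 / K \<le> m"
      unfolding m_def[of] by (intro cInf_greatest \<open>V \<noteq> {}\<close>) (auto simp: m_def)
    then show False
      using K c(1) by (simp add: divide_le_0_iff)
  qed
  then show ?thesis
    using m_le by (rule that)
qed

section \<open>Polynomials in an operator and spectral mapping\<close>

definition poly_op :: "('a::complex_hilbert_space \<Rightarrow>\<^sub>L 'a) \<Rightarrow> complex poly \<Rightarrow> ('a \<Rightarrow>\<^sub>L 'a)" where
  "poly_op A p = fold_coeffs (\<lambda>a Y. scalar_op a + (A o\<^sub>L Y)) p 0"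

lemma scalar_op_0 [simp]: "scalar_op 0 = 0"
  by (rule blinfun_eqI) (simp add: scaleC.zero_left)

lemma poly_op_0 [simp]: "poly_op A 0 = 0"
  by (simp add: poly_op_def)

lemma poly_op_pCons [simp]: "poly_op A (pCons a p) = scalar_op a + (A o\<^sub>L poly_op A p)"
proof (cases "a = 0 \<and> p = 0")
  \<comment> \<open>The zero polynomial has no coefficients to fold over, so this case is separate;
    both sides are 0.\<close>
  case True
  then show ?thesis by (auto intro!: blinfun_eqI simp: blinfun.zero_right blinfun.add_left)
next
  case False
  then show ?thesis by (auto simp: poly_op_def)
qed

lemma poly_op_1 [simp]: "poly_op A 1 = id_blinfun"
  by (rule blinfun_eqI) (simp add: one_pCons blinfun.add_left blinfun.zero_right)

lemma poly_op_add: "poly_op A (p + q) = poly_op A p + poly_op A q"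
  by (induction p q rule: poly_induct2)
    (auto intro!: blinfun_eqI simp: blinfun.add_left blinfun.add_right scaleC.add_left)

context
  fixes A :: "'a::complex_hilbert_space \<Rightarrow>\<^sub>L 'a"
  assumes A: "A \<in> bounded_operators"
begin

lemma poly_op_bounded_operators [simp]: "poly_op A p \<in> bounded_operators"
  by (induction p) (auto simp: A)

lemma poly_op_smult: "poly_op A (smult c p) x = c *\<^sub>C poly_op A p x"
  by (induction p)
    (auto simp: blinfun.add_left scaleC.add_right scaleC_scaleC bounded_operators_scaleC[OF A] scaleC.zero_right)

lemma poly_op_mult: "poly_op A (p * q) x = poly_op A p (poly_op A q x)"
  by (induction p arbitrary: x) (auto simp: blinfun.add_left poly_op_add poly_op_smult)

lemma poly_op_commute: "poly_op A p (A x) = A (poly_op A p x)"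
  by (induction p arbitrary: x)
    (auto simp: blinfun.add_left blinfun.add_right blinfun.zero_right bounded_operators_scaleC[OF A])

text \<open>Induction on the degree: the fundamental theorem of algebra splits off a factor with
  root z. The corresponding \<open>A - z\<close> is invertible since z lies outside the spectrum,
  and the cofactor is invertible by induction.\<close>

lemma invertible_poly_op:
  "q \<noteq> 0 \<Longrightarrow> (\<And>z. poly q z = 0 \<Longrightarrow> z \<notin> op_spectrum A) \<Longrightarrow> invertible_op (poly_op A q)"
proof (induction "degree q" arbitrary: q)
  case 0
  then obtain c where c: "q = [:c:]" "c \<noteq> 0"
    by (metis degree_eq_zeroE pCons_0_0)
  then show ?case
    by (auto simp: invertible_op_def blinfun.add_left blinfun.zero_right scaleC_scaleC
        intro!: bexI[of _ "scalar_op (inverse c)"])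
next
  case (Suc n)
  then obtain z where z: "poly q z = 0"
    using fundamental_theorem_of_algebra[of q] by (auto simp: constant_degree)
  then obtain s where s: "q = [:- z, 1:] * s"
    by (auto simp: poly_eq_0_iff_dvd elim: dvdE)
  with Suc.prems have "s \<noteq> 0" by auto
  then have "degree q = Suc (degree s)"
    unfolding s by (subst degree_mult_eq) auto
  then have "invertible_op (poly_op A s)"
    using Suc.hyps \<open>s \<noteq> 0\<close> Suc.prems(2) by (simp add: s)
  then obtain U where U: "U \<in> bounded_operators"
      "\<And>x. U (poly_op A s x) = x" "\<And>x. poly_op A s (U x) = x"
    by (auto simp: invertible_op_def)
  have "z \<notin> op_spectrum A"
    using Suc.prems(2) z by blast
  then obtain W where W: "W \<in> bounded_operators"
      "\<And>x. W (A x - z *\<^sub>C x) = x" "\<And>x. A (W x) - z *\<^sub>C W x = x"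
    by (auto simp: op_spectrum_def)
  have "poly_op A q x = A (poly_op A s x) - z *\<^sub>C poly_op A s x" for x
    unfolding s poly_op_mult
    by (simp add: blinfun.add_left blinfun.add_right blinfun.zero_right scaleC.minus_left)
  then show ?case
    unfolding invertible_op_def using U W by (intro bexI[of _ "U o\<^sub>L W"]) auto
qed

text \<open>One inclusion of the spectral mapping theorem, from \<open>invertible_poly_op\<close>
  for \<open>p - [:z:]\<close>. If this difference is the zero polynomial, any point of the nonempty
  spectrum is a witness.\<close>

lemma spectrum_poly_op:
  assumes z: "z \<in> op_spectrum (poly_op A p)" and ne: "op_spectrum A \<noteq> {}"
  obtains w where "w \<in> op_spectrum A" "poly p w = z"
proof (cases "p = [:z:]")
  case True
  with ne that show ?thesis by auto
next
  case False
  have "poly_op A (p - [:z:]) = poly_op A p - scalar_op z"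
    using poly_op_add[of A "p - [:z:]" "[:z:]"]
    by (auto intro!: blinfun_eqI simp: blinfun.add_left blinfun.diff_left blinfun.zero_right)
  then have "\<not> invertible_op (poly_op A (p - [:z:]))"
    using z by (simp add: op_spectrum_iff)
  then obtain w where "poly (p - [:z:]) w = 0" "w \<in> op_spectrum A"
    using invertible_poly_op[of "p - [:z:]"] False by auto
  then show ?thesis by (intro that[of w]) auto
qed

end

text \<open>Taking adjoints reverses the order of factors; commutation of A with polynomials in A
  restores it.\<close>

lemma cinner_poly_op:
  assumes A: "selfadjoint A"
  shows "cinner (poly_op A p x) y = cinner x (poly_op A (map_poly cnj p) y)"
proof (induction p arbitrary: x y)
  case (pCons a p)
  then show ?case
    using selfadjointD[OF A]
    by (simp add: map_poly_pCons blinfun.add_left cinner.add_left cinner.add_right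
        cinner_scaleC_left cinner_scaleC_right poly_op_commute)
qed (simp add: cinner.zero_left cinner.zero_right)

text \<open>With \<open>q\<close> the polynomial \<open>c\<^sup>2\<close> minus
  \<open>map_poly cnj p * p\<close>, the form of \<open>poly_op A q\<close> is
  \<open>(c * norm x)\<^sup>2 - (norm (poly_op A p x))\<^sup>2\<close>. By
  \<open>spectrum_le_form\<close> it is nonnegative once the spectrum of \<open>poly_op A q\<close>
  is, and spectral mapping reduces this to the hypothesis on p.\<close>

lemma poly_op_norm_le:
  assumes A: "selfadjoint A" and c: "c \<ge> 0"
    and p: "\<And>z. z \<in> op_spectrum A \<Longrightarrow> cmod (poly p z) \<le> c"
  shows "norm (poly_op A p) \<le> c"
proof (rule norm_blinfun_bound[OF c])
  fix x
  have A': "A \<in> bounded_operators" by (rule selfadjointD[OF A])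
  define q where "q = [:of_real (c\<^sup>2):] - map_poly cnj p * p"
  have q_apply: "poly_op A q x = of_real (c\<^sup>2) *\<^sub>C x - poly_op A (map_poly cnj p) (poly_op A p x)" for x
    using arg_cong[where f = "\<lambda>T. blinfun_apply T x",
        OF poly_op_add[of A q "map_poly cnj p * p"]]
    by (simp add: q_def poly_op_mult[OF A'] blinfun.add_left blinfun.zero_right)
  have cinner_q: "cinner (poly_op A q x) y = of_real (c\<^sup>2) * cinner x y - cinner (poly_op A p x) (poly_op A p y)"
    for x y
    by (simp add: q_apply cinner.diff_left cinner_scaleC_left cinner_poly_op[OF A, of "map_poly cnj p"]
        map_poly_map_poly o_def del: of_real_power)
  have q: "selfadjoint (poly_op A q)"
    unfolding selfadjoint_def
  proof (intro conjI allI)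
    show "cinner (poly_op A q x) y = cinner x (poly_op A q y)" for x y
      using cinner_q[of x y] cinner_q[of y x] cinner_commute[of x "poly_op A q y"]
        cinner_commute[of x y] cinner_commute[of "poly_op A p x" "poly_op A p y"] by simp
  qed (simp add: A')
  have "(norm (poly_op A p x))\<^sup>2 \<le> (c * norm x)\<^sup>2"
  proof (cases "x = 0")
    case False
    obtain m where m: "of_real m \<in> op_spectrum (poly_op A q)"
        "m * (norm x)\<^sup>2 \<le> Re (cinner (poly_op A q x) x)"
      using spectrum_le_form[OF q False] .
    have "op_spectrum A \<noteq> {}"
      using spectrum_le_form[OF A False] by blast
    then obtain z where z: "z \<in> op_spectrum A" "poly q z = of_real m"
      using spectrum_poly_op[OF A' m(1)] by blast
    \<comment> \<open>At a real point conjugating the coefficients conjugates the value, so the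
      product in \<open>q\<close> becomes a squared modulus.\<close>
    have "cnj z = z"
      using selfadjoint_spectrum_real[OF A z(1)] by (simp add: complex_eq_iff)
    then have "poly q z = of_real (c\<^sup>2 - (cmod (poly p z))\<^sup>2)"
      by (simp add: q_def complex_norm_square mult.commute del: of_real_power)
    with z(2) have "m = c\<^sup>2 - (cmod (poly p z))\<^sup>2"
      by (metis of_real_eq_iff)
    then have "0 \<le> m"
      using p[OF z(1)] by (simp add: power_mono)
    then have "0 \<le> Re (cinner (poly_op A q x) x)"
      using m(2) by (meson order_trans mult_nonneg_nonneg zero_le_power2)
    then show ?thesis
      by (simp add: cinner_q cinner_self power_mult_distrib)
  qed (simp add: blinfun.zero_right)
  then show "norm (poly_op A p x) \<le> c * norm x"
    using c by (simp add: power2_le_iff_abs_le)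
qed

subsection \<open>Continuous functional calculus\<close>

context
  fixes A :: "'a::complex_hilbert_space \<Rightarrow>\<^sub>L 'a"
  assumes A: "selfadjoint A"
begin

lemma compact_op_spectrum: "compact (op_spectrum A)"
proof -
  have "op_spectrum A = complex_of_real ` {t. complex_of_real t \<in> op_spectrum A}"
  proof (intro equalityI subsetI)
    fix z assume z: "z \<in> op_spectrum A"
    then have "z = of_real (Re z)"
      using selfadjoint_spectrum_real[OF A z] by (simp add: complex_eq_iff)
    with z show "z \<in> complex_of_real ` {t. complex_of_real t \<in> op_spectrum A}"
      by (metis imageI mem_Collect_eq)
  qed auto
  then show ?thesis
    by (metis compact_real_spectrum[OF A] compact_continuous_image continuous_on_of_real_id)
qed

lemma poly_op_diff_norm_le:
  assumes "c \<ge> 0" "\<And>z. z \<in> op_spectrum A \<Longrightarrow> cmod (poly p z - poly q z) \<le> c"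
  shows "norm (poly_op A p - poly_op A q) \<le> c"
proof -
  have "poly_op A p - poly_op A q = poly_op A (p - q)"
    using poly_op_add[of A "p - q" q] by simp
  then show ?thesis
    using poly_op_norm_le[OF A, of c "p - q"] assms by simp
qed

text \<open>The spectrum is real and compact, so Stone-Weierstrass approximates real and imaginary
  parts by real polynomials p and q; \<open>p + \<i> q\<close> is then a complex polynomial close to
  f.\<close>

lemma uniform_poly_approximation:
  assumes f: "continuous_on (op_spectrum A) f"
  obtains P where "uniform_limit (op_spectrum A) (\<lambda>n. poly (P n)) f sequentially"
proof -
  let ?S = "{t. complex_of_real t \<in> op_spectrum A}"
  have approx: "\<exists>p :: real poly. \<forall>t\<in>?S. \<bar>h t - poly p t\<bar> < e"
    if h: "continuous_on ?S h" and e: "e > 0" for h and e :: real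
  proof -
    obtain g where "real_polynomial_function g" and g: "\<And>t. t \<in> ?S \<Longrightarrow> \<bar>h t - g t\<bar> < e"
      using Stone_Weierstrass_real_polynomial_function[OF compact_real_spectrum[OF A] h e] by blast
    then obtain a n where "g = (\<lambda>t. \<Sum>i\<le>n. a i * t ^ i)"
      by (auto simp: real_polynomial_function_iff_sum)
    then have "g t = poly (\<Sum>i\<le>n. monom (a i) i) t" for t
      by (simp add: poly_sum poly_monom)
    with g show ?thesis by metis
  qed
  have f': "continuous_on ?S (\<lambda>t. f (of_real t))"
    by (rule continuous_on_compose2[OF f]) (auto intro: continuous_intros)
  have "\<exists>p :: complex poly. \<forall>z\<in>op_spectrum A. dist (poly p z) (f z) < 1 / real (Suc n)" for n
  proof -
    let ?e = "1 / real (Suc n)"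
    have e2: "?e / 2 > 0" by simp
    obtain p where p: "\<And>t. t \<in> ?S \<Longrightarrow> \<bar>Re (f (of_real t)) - poly p t\<bar> < ?e / 2"
      using approx[OF continuous_on_Re[OF f'] e2] by blast
    obtain q where q: "\<And>t. t \<in> ?S \<Longrightarrow> \<bar>Im (f (of_real t)) - poly q t\<bar> < ?e / 2"
      using approx[OF continuous_on_Im[OF f'] e2] by blast
    have of_real: "poly (map_poly complex_of_real p) (of_real t) = of_real (poly p t)" for p t
      by (induction p) (auto simp: map_poly_pCons)
    define s where "s = map_poly complex_of_real p + smult \<i> (map_poly complex_of_real q)"
    have "dist (poly s z) (f z) < ?e" if z: "z \<in> op_spectrum A" for z
    proof -
      have zr: "z = of_real (Re z)"
        using selfadjoint_spectrum_real[OF A z] by (simp add: complex_eq_iff)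
      then have mem: "Re z \<in> ?S" using z by simp
      have "poly s (of_real (Re z)) = of_real (poly p (Re z)) + \<i> * of_real (poly q (Re z))"
        by (simp add: s_def of_real)
      then have "Re (f z - poly s z) = Re (f (of_real (Re z))) - poly p (Re z)"
        "Im (f z - poly s z) = Im (f (of_real (Re z))) - poly q (Re z)"
        using zr by auto
      then have "\<bar>Re (f z - poly s z)\<bar> < ?e / 2" "\<bar>Im (f z - poly s z)\<bar> < ?e / 2"
        using p[OF mem] q[OF mem] by simp_all
      then have "cmod (f z - poly s z) < ?e"
        using cmod_le[of "f z - poly s z"] by linarith
      then show ?thesis
        by (simp add: dist_norm norm_minus_commute)
    qed
    then show ?thesis by blast
  qed
  then obtain P where P: "\<And>n z. z \<in> op_spectrum A \<Longrightarrow> dist (poly (P n) z) (f z) < 1 / real (Suc n)"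
    by metis
  have "uniform_limit (op_spectrum A) (\<lambda>n. poly (P n)) f sequentially"
  proof (rule uniform_limitI)
    fix e :: real assume "e > 0"
    then obtain N where N: "1 / real (Suc N) < e"
      using nat_approx_posE by blast
    have "dist (poly (P n) z) (f z) < e" if "n \<ge> N" "z \<in> op_spectrum A" for n z
    proof -
      have "1 / real (Suc n) \<le> 1 / real (Suc N)"
        using that(1) by (simp add: field_simps)
      then show ?thesis
        using P[OF that(2), of n] N by linarith
    qed
    then show "\<forall>\<^sub>F n in sequentially. \<forall>z\<in>op_spectrum A. dist (poly (P n) z) (f z) < e"
      unfolding eventually_sequentially by blast
  qed
  then show ?thesis by (rule that)
qed

text \<open>Uniform closeness on the spectrum is closeness in operator norm, so the operators form a
  Cauchy sequence in a complete space.\<close>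

lemma poly_op_convergent:
  assumes P: "uniform_limit (op_spectrum A) (\<lambda>n. poly (P n)) f sequentially"
  obtains B where "(\<lambda>n. poly_op A (P n)) \<longlonglongrightarrow> B"
proof -
  have "Cauchy (\<lambda>n. poly_op A (P n))"
  proof (rule metric_CauchyI)
    fix e :: real assume e: "e > 0"
    then obtain N where N: "\<And>n z. n \<ge> N \<Longrightarrow> z \<in> op_spectrum A \<Longrightarrow> dist (poly (P n) z) (f z) < e / 4"
      using uniform_limitD[OF P, of "e / 4"] by (auto simp: eventually_sequentially)
    have "dist (poly_op A (P m)) (poly_op A (P n)) < e" if "m \<ge> N" "n \<ge> N" for m n
    proof -
      have "norm (poly_op A (P m) - poly_op A (P n)) \<le> e / 2"
      proof (rule poly_op_diff_norm_le)
        show "cmod (poly (P m) z - poly (P n) z) \<le> e / 2" if z: "z \<in> op_spectrum A" for z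
          using dist_triangle2[of "poly (P m) z" "poly (P n) z" "f z"]
            N[OF \<open>m \<ge> N\<close> z] N[OF \<open>n \<ge> N\<close> z] by (simp add: dist_norm)
      qed (use e in simp)
      with e show ?thesis by (simp add: dist_norm)
    qed
    then show "\<exists>M. \<forall>m\<ge>M. \<forall>n\<ge>M. dist (poly_op A (P m)) (poly_op A (P n)) < e" by blast
  qed
  then show ?thesis
    using that Cauchy_convergent_iff convergent_def by blast
qed

text \<open>Allowing two functions gives two facts at once: the limit does not depend on the
  approximating sequence, and it depends only on the values on the spectrum.\<close>

lemma poly_op_limit_unique:
  assumes P: "uniform_limit (op_spectrum A) (\<lambda>n. poly (P n)) f sequentially"
    and Q: "uniform_limit (op_spectrum A) (\<lambda>n. poly (Q n)) g sequentially"
    and B: "(\<lambda>n. poly_op A (P n)) \<longlonglongrightarrow> B" and C: "(\<lambda>n. poly_op A (Q n)) \<longlonglongrightarrow> C"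
    and eq: "\<And>z. z \<in> op_spectrum A \<Longrightarrow> f z = g z"
  shows "B = C"
proof -
  have lim: "(\<lambda>n. norm (poly_op A (P n) - poly_op A (Q n))) \<longlonglongrightarrow> norm (B - C)"
    by (intro tendsto_intros B C)
  have "norm (B - C) \<le> e" if e: "e > 0" for e
  proof (rule tendsto_upperbound[OF lim])
    have "\<forall>\<^sub>F n in sequentially. \<forall>z\<in>op_spectrum A. dist (poly (P n) z) (f z) < e / 2"
      using uniform_limitD[OF P, of "e / 2"] e by simp
    moreover have "\<forall>\<^sub>F n in sequentially. \<forall>z\<in>op_spectrum A. dist (poly (Q n) z) (g z) < e / 2"
      using uniform_limitD[OF Q, of "e / 2"] e by simp
    ultimately show "\<forall>\<^sub>F n in sequentially. norm (poly_op A (P n) - poly_op A (Q n)) \<le> e"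
    proof eventually_elim
      case (elim n)
      show ?case
      proof (rule poly_op_diff_norm_le)
        show "cmod (poly (P n) z - poly (Q n) z) \<le> e" if z: "z \<in> op_spectrum A" for z
        proof -
          have "dist (poly (P n) z) (f z) < e / 2" "dist (poly (Q n) z) (f z) < e / 2"
            using elim z eq[OF z] by auto
          then show ?thesis
            using dist_triangle2[of "poly (P n) z" "poly (Q n) z" "f z"]
            by (simp add: dist_norm)
        qed
      qed (use e in simp)
    qed
  qed simp
  then have "norm (B - C) \<le> 0"
    by (metis field_le_epsilon add_0)
  then show ?thesis by simp
qed

text \<open>The concrete calculus: its homomorphism laws give existence for the definite description
  in \<open>cfc\<close>, and comparison with it gives uniqueness.\<close>

definition poly_calculus :: "(complex \<Rightarrow> complex) \<Rightarrow> ('a \<Rightarrow>\<^sub>L 'a)" where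
  "poly_calculus f = (THE B. \<exists>P. uniform_limit (op_spectrum A) (\<lambda>n. poly (P n)) f sequentially \<and>
    (\<lambda>n. poly_op A (P n)) \<longlonglongrightarrow> B)"

lemma poly_calculus_eqI:
  assumes "uniform_limit (op_spectrum A) (\<lambda>n. poly (P n)) f sequentially"
    and "(\<lambda>n. poly_op A (P n)) \<longlonglongrightarrow> B"
  shows "poly_calculus f = B"
  unfolding poly_calculus_def
proof (rule the_equality)
  show "C = B" if "\<exists>P. uniform_limit (op_spectrum A) (\<lambda>n. poly (P n)) f sequentially \<and>
    (\<lambda>n. poly_op A (P n)) \<longlonglongrightarrow> C" for C
    using that poly_op_limit_unique assms by blast
qed (use assms in blast)

lemma poly_calculusE:
  assumes "continuous_on (op_spectrum A) f"
  obtains P where "uniform_limit (op_spectrum A) (\<lambda>n. poly (P n)) f sequentially"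
    and "(\<lambda>n. poly_op A (P n)) \<longlonglongrightarrow> poly_calculus f"
  using uniform_poly_approximation[OF assms] poly_op_convergent poly_calculus_eqI by metis

lemma poly_calculus_poly: "poly_calculus (poly p) = poly_op A p"
  by (rule poly_calculus_eqI[of "\<lambda>_. p"]) (auto intro: uniform_limit_const)

text \<open>Each law holds for polynomials and passes to the limit along uniformly convergent
  approximations.\<close>

lemma poly_calculus_is_functional_calculus: "is_functional_calculus A poly_calculus"
proof -
  have A': "A \<in> bounded_operators" by (rule selfadjointD[OF A])
  have poly_fun: "poly (smult c p) = (\<lambda>z. c * poly p z)" "poly (p + q) = (\<lambda>z. poly p z + poly q z)"
    "poly (p * q) = (\<lambda>z. poly p z * poly q z)" for c :: complex and p q
    by (simp_all add: fun_eq_iff)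
  have bounded_if_cont: "bounded (h ` op_spectrum A)"
    if "continuous_on (op_spectrum A) h" for h :: "complex \<Rightarrow> complex"
    by (intro compact_imp_bounded compact_continuous_image that compact_op_spectrum)
  have "poly_calculus (poly 1) = id_blinfun" "poly_calculus (poly [:0, 1:]) = A"
    unfolding poly_calculus_poly
    by (auto intro!: blinfun_eqI simp: blinfun.add_left blinfun.add_right blinfun.zero_right)
  moreover have "poly 1 = (\<lambda>z::complex. 1)" "poly [:0, 1:] = (\<lambda>z::complex. z)"
    by (auto simp: fun_eq_iff)
  ultimately have 1: "poly_calculus (\<lambda>z. 1) = id_blinfun" "poly_calculus (\<lambda>z. z) = A"
    by simp_all
  have 2: "poly_calculus f \<in> bounded_operators \<and>
      (\<forall>c x. poly_calculus (\<lambda>z. c * f z) x = c *\<^sub>C poly_calculus f x) \<and>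
      poly_calculus (\<lambda>z. cnj (f z)) = hilbert_adjoint (poly_calculus f) \<and>
      (\<forall>g. continuous_on (op_spectrum A) g \<longrightarrow>
        poly_calculus (\<lambda>z. f z + g z) = poly_calculus f + poly_calculus g \<and>
        poly_calculus (\<lambda>z. f z * g z) = poly_calculus f o\<^sub>L poly_calculus g \<and>
        ((\<forall>z\<in>op_spectrum A. f z = g z) \<longrightarrow> poly_calculus f = poly_calculus g))"
    if f: "continuous_on (op_spectrum A) f" for f
  proof -
    obtain P where P: "uniform_limit (op_spectrum A) (\<lambda>n. poly (P n)) f sequentially"
        and PB: "(\<lambda>n. poly_op A (P n)) \<longlonglongrightarrow> poly_calculus f"
      using poly_calculusE[OF f] .
    have PB': "(\<lambda>n. poly_op A (P n) x) \<longlonglongrightarrow> poly_calculus f x" for x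
      by (intro blinfun.tendsto PB tendsto_const)
    have bounded: "poly_calculus f \<in> bounded_operators"
    proof -
      have "poly_calculus f (c *\<^sub>C x) = c *\<^sub>C poly_calculus f x" for c x
      proof (rule LIMSEQ_unique[OF PB'])
        show "(\<lambda>n. poly_op A (P n) (c *\<^sub>C x)) \<longlonglongrightarrow> c *\<^sub>C poly_calculus f x"
          unfolding bounded_operators_scaleC[OF poly_op_bounded_operators[OF A']]
          by (intro scaleC.tendsto tendsto_const PB')
      qed
      then show ?thesis by (simp add: bounded_operators_def)
    qed
    have scale: "poly_calculus (\<lambda>z. c * f z) x = c *\<^sub>C poly_calculus f x" for c x
    proof -
      have "poly_calculus (\<lambda>z. c * f z) = scalar_op c o\<^sub>L poly_calculus f"
      proof (rule poly_calculus_eqI)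
        show "uniform_limit (op_spectrum A) (\<lambda>n. poly (smult c (P n))) (\<lambda>z. c * f z) sequentially"
          using bounded_linear.uniform_limit[OF bounded_linear_mult_right P] by (simp add: poly_fun)
        have "poly_op A (smult c (P n)) = scalar_op c o\<^sub>L poly_op A (P n)" for n
          by (rule blinfun_eqI) (simp add: poly_op_smult[OF A'])
        then show "(\<lambda>n. poly_op A (smult c (P n))) \<longlonglongrightarrow> (scalar_op c o\<^sub>L poly_calculus f)"
          using PB by (auto intro: tendsto_intros)
      qed
      then show ?thesis by simp
    qed
    have adj: "poly_calculus (\<lambda>z. cnj (f z)) = hilbert_adjoint (poly_calculus f)"
    proof -
      \<comment> \<open>Reality of the spectrum is what makes polynomials with conjugated
        coefficients approximate the conjugate function.\<close>
      have "poly (map_poly cnj p) z = cnj (poly p z)" if "z \<in> op_spectrum A" for p z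
        using selfadjoint_spectrum_real[OF A that]
        by (metis Reals_cnj_iff complex_is_Real_iff poly_map_poly_cnj)
      moreover have "uniform_limit (op_spectrum A) (\<lambda>n z. cnj (poly (P n) z)) (\<lambda>z. cnj (f z)) sequentially"
        using bounded_linear.uniform_limit[OF bounded_linear_cnj P] by simp
      ultimately have Q: "uniform_limit (op_spectrum A) (\<lambda>n. poly (map_poly cnj (P n)))
          (\<lambda>z. cnj (f z)) sequentially"
        by (subst uniform_limit_cong') auto
      then obtain C where C: "(\<lambda>n. poly_op A (map_poly cnj (P n))) \<longlonglongrightarrow> C"
        by (rule poly_op_convergent)
      have "hilbert_adjoint (poly_calculus f) = C"
      proof (rule hilbert_adjoint_eqI)
        fix x y
        have "(\<lambda>n. cinner (poly_op A (P n) x) y) \<longlonglongrightarrow> cinner (poly_calculus f x) y"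
          by (intro cinner.tendsto tendsto_const PB')
        moreover have "(\<lambda>n. cinner (poly_op A (P n) x) y) \<longlonglongrightarrow> cinner x (C y)"
          unfolding cinner_poly_op[OF A]
          by (intro cinner.tendsto tendsto_const blinfun.tendsto C)
        ultimately show "cinner (poly_calculus f x) y = cinner x (C y)"
          by (rule LIMSEQ_unique)
      qed
      with poly_calculus_eqI[OF Q C] show ?thesis by simp
    qed
    have "poly_calculus (\<lambda>z. f z + g z) = poly_calculus f + poly_calculus g \<and>
        poly_calculus (\<lambda>z. f z * g z) = poly_calculus f o\<^sub>L poly_calculus g \<and>
        ((\<forall>z\<in>op_spectrum A. f z = g z) \<longrightarrow> poly_calculus f = poly_calculus g)"
      if g: "continuous_on (op_spectrum A) g" for g
    proof -
      obtain Q where Q: "uniform_limit (op_spectrum A) (\<lambda>n. poly (Q n)) g sequentially"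
          and QC: "(\<lambda>n. poly_op A (Q n)) \<longlonglongrightarrow> poly_calculus g"
        using poly_calculusE[OF g] .
      have "poly_calculus (\<lambda>z. f z + g z) = poly_calculus f + poly_calculus g"
      proof (rule poly_calculus_eqI)
        show "uniform_limit (op_spectrum A) (\<lambda>n. poly (P n + Q n)) (\<lambda>z. f z + g z) sequentially"
          using uniform_limit_add[OF P Q] by (simp add: poly_fun)
        show "(\<lambda>n. poly_op A (P n + Q n)) \<longlonglongrightarrow> poly_calculus f + poly_calculus g"
          unfolding poly_op_add by (intro tendsto_intros PB QC)
      qed
      moreover have "poly_calculus (\<lambda>z. f z * g z) = poly_calculus f o\<^sub>L poly_calculus g"
      proof (rule poly_calculus_eqI)
        show "uniform_limit (op_spectrum A) (\<lambda>n. poly (P n * Q n)) (\<lambda>z. f z * g z) sequentially"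
          \<comment> \<open>Uniform limits multiply when the limit functions are bounded, which
            compactness of the spectrum ensures.\<close>
          using uniform_lim_mult[OF P Q] bounded_if_cont[OF f] bounded_if_cont[OF g] by (simp add: poly_fun)
        have "poly_op A (P n * Q n) = poly_op A (P n) o\<^sub>L poly_op A (Q n)" for n
          by (rule blinfun_eqI) (simp add: poly_op_mult[OF A'])
        then show "(\<lambda>n. poly_op A (P n * Q n)) \<longlonglongrightarrow> (poly_calculus f o\<^sub>L poly_calculus g)"
          using PB QC by (auto intro: tendsto_intros)
      qed
      ultimately show ?thesis
        using poly_op_limit_unique[OF P Q PB QC] by blast
    qed
    with bounded scale adj show ?thesis by blast
  qed
  show ?thesis
    unfolding is_functional_calculus_def using 1 2 by (intro conjI allI impI) blast+
qed

section \<open>Automatic continuity and uniqueness of the functional calculus\<close>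

context
  fixes \<Phi>
  assumes \<Phi>: "is_functional_calculus A \<Phi>"
begin

lemma functional_calculusD:
  assumes "continuous_on (op_spectrum A) f"
  shows "\<Phi> f \<in> bounded_operators" "\<Phi> (\<lambda>z. c * f z) x = c *\<^sub>C \<Phi> f x"
    "\<Phi> (\<lambda>z. cnj (f z)) = hilbert_adjoint (\<Phi> f)"
    "continuous_on (op_spectrum A) g \<Longrightarrow> \<Phi> (\<lambda>z. f z + g z) = \<Phi> f + \<Phi> g"
    "continuous_on (op_spectrum A) g \<Longrightarrow> \<Phi> (\<lambda>z. f z * g z) = \<Phi> f o\<^sub>L \<Phi> g"
    "continuous_on (op_spectrum A) g \<Longrightarrow> (\<And>z. z \<in> op_spectrum A \<Longrightarrow> f z = g z) \<Longrightarrow> \<Phi> f = \<Phi> g"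
  using \<Phi> assms unfolding is_functional_calculus_def by blast+

lemma functional_calculus_one_id: "\<Phi> (\<lambda>z. 1) = id_blinfun" "\<Phi> (\<lambda>z. z) = A"
  using \<Phi> unfolding is_functional_calculus_def by blast+

lemma functional_calculus_const: "\<Phi> (\<lambda>z. c) x = c *\<^sub>C x"
  using functional_calculusD(2)[OF continuous_on_const, of c 1 x] functional_calculus_one_id by simp

lemma functional_calculus_real_selfadjoint:
  assumes "continuous_on (op_spectrum A) (\<lambda>z. complex_of_real (h z))"
  shows "selfadjoint (\<Phi> (\<lambda>z. complex_of_real (h z)))"
  using functional_calculusD(1,3)[OF assms] cinner_hilbert_adjoint_right
  unfolding selfadjoint_def complex_cnj_complex_of_real by metis

text \<open>Writing h as the square of s, its pointwise square root, turns the form into the squared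
  norm of \<open>\<Phi> s x\<close>, since \<open>\<Phi> s\<close> is self-adjoint.\<close>

lemma functional_calculus_nonneg_form:
  assumes h: "continuous_on (op_spectrum A) (\<lambda>z. complex_of_real (h z))"
    and nonneg: "\<And>z. z \<in> op_spectrum A \<Longrightarrow> 0 \<le> h z"
  shows "0 \<le> Re (cinner (\<Phi> (\<lambda>z. complex_of_real (h z)) x) x)"
proof -
  define s where "s z = complex_of_real (sqrt (h z))" for z
  have "continuous_on (op_spectrum A) (\<lambda>z. complex_of_real (sqrt (Re (complex_of_real (h z)))))"
    by (intro continuous_intros h)
  then have s: "continuous_on (op_spectrum A) s"
    by (simp add: s_def[abs_def])
  have "\<Phi> (\<lambda>z. complex_of_real (h z)) = \<Phi> (\<lambda>z. s z * s z)"
    using nonneg by (intro functional_calculusD(6) h continuous_on_mult s)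
      (simp add: s_def flip: of_real_mult)
  also have "\<dots> = \<Phi> s o\<^sub>L \<Phi> s"
    by (intro functional_calculusD s)
  finally have "cinner (\<Phi> (\<lambda>z. complex_of_real (h z)) x) x = cinner (\<Phi> s x) (\<Phi> s x)"
    using selfadjointD(2)[OF functional_calculus_real_selfadjoint, of "\<lambda>z. sqrt (h z)"] s
    by (simp add: s_def[abs_def])
  then show ?thesis by simp
qed

text \<open>\<open>is_functional_calculus\<close> demands no continuity, but a star-homomorphism is
  contractive: positivity for \<open>c\<^sup>2\<close> minus the squared modulus of f is exactly the
  squared norm estimate.\<close>

lemma functional_calculus_norm_le:
  assumes f: "continuous_on (op_spectrum A) f" and c: "c \<ge> 0"
    and le: "\<And>z. z \<in> op_spectrum A \<Longrightarrow> cmod (f z) \<le> c"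
  shows "norm (\<Phi> f) \<le> c"
proof (rule norm_blinfun_bound[OF c])
  fix x
  define h where "h z = c\<^sup>2 - (cmod (f z))\<^sup>2" for z
  have h: "continuous_on (op_spectrum A) (\<lambda>z. complex_of_real (h z))"
    unfolding h_def by (intro continuous_intros f)
  have "0 \<le> Re (cinner (\<Phi> (\<lambda>z. complex_of_real (h z)) x) x)"
    by (rule functional_calculus_nonneg_form[OF h]) (simp add: h_def le power_mono)
  moreover have "\<Phi> (\<lambda>z. complex_of_real (h z) + cnj (f z) * f z)
      = \<Phi> (\<lambda>z. complex_of_real (h z)) + (\<Phi> (\<lambda>z. cnj (f z)) o\<^sub>L \<Phi> f)"
    by (subst functional_calculusD(4), intro h, intro continuous_intros f,
        subst functional_calculusD(5), intro continuous_intros f, rule f, rule refl)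
  moreover have "(\<lambda>z. complex_of_real (h z) + cnj (f z) * f z) = (\<lambda>z. of_real (c\<^sup>2))"
    by (simp add: h_def fun_eq_iff complex_norm_square mult.commute del: of_real_power)
  ultimately have "Re (cinner (\<Phi> (\<lambda>z. cnj (f z)) (\<Phi> f x)) x) \<le> Re (cinner (\<Phi> (\<lambda>z. of_real (c\<^sup>2)) x) x)"
    by (simp add: blinfun.add_left cinner.add_left)
  moreover have "Re (cinner (\<Phi> (\<lambda>z. cnj (f z)) (\<Phi> f x)) x) = (norm (\<Phi> f x))\<^sup>2"
    unfolding functional_calculusD(3)[OF f] Re_cinner_commute[of _ x]
    by (simp flip: cinner_hilbert_adjoint_right[OF functional_calculusD(1)[OF f]])
  ultimately have "(norm (\<Phi> f x))\<^sup>2 \<le> (c * norm x)\<^sup>2"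
    by (simp add: functional_calculus_const cinner_scaleC_left cinner_self power_mult_distrib)
  then show "norm (\<Phi> f x) \<le> c * norm x"
    using c by (simp add: power2_le_iff_abs_le)
qed

lemma functional_calculus_poly: "\<Phi> (poly p) = poly_op A p"
proof (induction p)
  case 0
  then show ?case
    by (auto intro!: blinfun_eqI simp: functional_calculus_const scaleC.zero_left)
next
  case (pCons a p)
  have "\<Phi> (poly (pCons a p)) = \<Phi> (\<lambda>z. a) + (\<Phi> (\<lambda>z. z) o\<^sub>L \<Phi> (poly p))"
  proof -
    have "continuous_on (op_spectrum A) (\<lambda>z. a)" "continuous_on (op_spectrum A) (\<lambda>z. z)"
      "continuous_on (op_spectrum A) (poly p)" "continuous_on (op_spectrum A) (\<lambda>z. z * poly p z)"
      by (intro continuous_intros)+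
    then show ?thesis
      by (simp add: functional_calculusD(4,5) fun_eq_iff poly_pCons[abs_def])
  qed
  moreover have "\<Phi> (\<lambda>z. a) = scalar_op a"
    by (auto intro!: blinfun_eqI simp: functional_calculus_const)
  ultimately show ?case
    using pCons by (simp add: functional_calculus_one_id del: poly_pCons)
qed

text \<open>All calculi agree on polynomials, and contractivity carries this to uniform
  limits.\<close>

lemma functional_calculus_unique:
  assumes f: "continuous_on (op_spectrum A) f"
  shows "\<Phi> f = poly_calculus f"
proof -
  obtain P where P: "uniform_limit (op_spectrum A) (\<lambda>n. poly (P n)) f sequentially"
      and PB: "(\<lambda>n. poly_op A (P n)) \<longlonglongrightarrow> poly_calculus f"
    using poly_calculusE[OF f] .
  have "(\<lambda>n. poly_op A (P n)) \<longlonglongrightarrow> \<Phi> f"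
  proof (rule metric_LIMSEQ_I)
    fix e :: real assume e: "e > 0"
    obtain N where N: "\<And>n z. n \<ge> N \<Longrightarrow> z \<in> op_spectrum A \<Longrightarrow> dist (poly (P n) z) (f z) < e / 2"
      using uniform_limitD[OF P, of "e / 2"] e by (auto simp: eventually_sequentially)
    have "dist (poly_op A (P n)) (\<Phi> f) < e" if n: "n \<ge> N" for n
    proof -
      have "\<Phi> (poly (P n)) = \<Phi> (\<lambda>z. (poly (P n) z - f z) + f z)" by simp
      also have "\<dots> = \<Phi> (\<lambda>z. poly (P n) z - f z) + \<Phi> f"
        by (intro functional_calculusD(4) continuous_intros f)
      finally have "poly_op A (P n) - \<Phi> f = \<Phi> (\<lambda>z. poly (P n) z - f z)"
        by (simp add: functional_calculus_poly)
      also have "norm \<dots> \<le> e / 2"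
        using e N[OF n] by (intro functional_calculus_norm_le continuous_intros f)
          (auto simp: dist_norm less_imp_le)
      finally show ?thesis
        using e by (simp add: dist_norm)
    qed
    then show "\<exists>N. \<forall>n\<ge>N. dist (poly_op A (P n)) (\<Phi> f) < e" by blast
  qed
  then show ?thesis
    using PB LIMSEQ_unique by blast
qed

end

lemma cfc_eq_poly_calculus:
  assumes f: "continuous_on (op_spectrum A) f"
  shows "cfc A f = poly_calculus f"
  unfolding cfc_def
  by (rule the_equality) (use functional_calculus_unique[OF _ f] poly_calculus_is_functional_calculus in blast)+

text \<open>\<open>cfc A\<close> is identified with \<open>poly_calculus\<close> only on continuous
  functions, so each law is transferred separately, with continuity checked for every function in
  it.\<close>

lemma cfc_is_functional_calculus: "is_functional_calculus A (cfc A)"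
proof -
  note pc = functional_calculusD[OF poly_calculus_is_functional_calculus]
  have cont: "continuous_on (op_spectrum A) (\<lambda>z. c * f z)" "continuous_on (op_spectrum A) (\<lambda>z. cnj (f z))"
    if "continuous_on (op_spectrum A) f" for f :: "complex \<Rightarrow> complex" and c
    by (intro continuous_intros that)+
  have const_id: "continuous_on (op_spectrum A) (\<lambda>z. 1 :: complex)" "continuous_on (op_spectrum A) (\<lambda>z. z)"
    by (intro continuous_intros)+
  note eq = cfc_eq_poly_calculus
  show ?thesis
    unfolding is_functional_calculus_def
  proof (intro conjI allI impI)
    fix f :: "complex \<Rightarrow> complex" assume f: "continuous_on (op_spectrum A) f"
    show "cfc A f \<in> bounded_operators"
      unfolding eq[OF f] by (rule pc(1)[OF f])
    show "cfc A (\<lambda>z. c * f z) x = c *\<^sub>C cfc A f x" for c x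
      unfolding eq[OF f] eq[OF cont(1)[OF f]] by (rule pc(2)[OF f])
    show "cfc A (\<lambda>z. cnj (f z)) = hilbert_adjoint (cfc A f)"
      unfolding eq[OF f] eq[OF cont(2)[OF f]] by (rule pc(3)[OF f])
    fix g :: "complex \<Rightarrow> complex" assume g: "continuous_on (op_spectrum A) g"
    show "cfc A (\<lambda>z. f z + g z) = cfc A f + cfc A g"
      unfolding eq[OF f] eq[OF g] eq[OF continuous_on_add[OF f g]] by (rule pc(4)[OF f g])
    show "cfc A (\<lambda>z. f z * g z) = cfc A f o\<^sub>L cfc A g"
      unfolding eq[OF f] eq[OF g] eq[OF continuous_on_mult[OF f g]] by (rule pc(5)[OF f g])
    show "cfc A f = cfc A g" if "\<forall>z\<in>op_spectrum A. f z = g z"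
      unfolding eq[OF f] eq[OF g] by (rule pc(6)[OF f g]) (use that in blast)
  qed (simp_all only: eq[OF const_id(1)] eq[OF const_id(2)]
      functional_calculus_one_id[OF poly_calculus_is_functional_calculus])
qed

end

subsection \<open>Powers of positive operators and the numerical radius\<close>

definition positive_op :: "('a::complex_hilbert_space \<Rightarrow>\<^sub>L 'a) \<Rightarrow> bool" where
  "positive_op A \<longleftrightarrow> selfadjoint A \<and> (\<forall>x. 0 \<le> Re (cinner (A x) x))"

lemma positive_opD:
  assumes "positive_op A"
  shows "selfadjoint A" "A \<in> bounded_operators" "0 \<le> Re (cinner (A x) x)"
    "cinner (A x) y = cinner x (A y)" "z \<in> op_spectrum A \<Longrightarrow> 0 \<le> Re z"
  using assms selfadjointD positive_spectrum_nonneg unfolding positive_op_def by blast+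

lemma cfc_homomorphism:
  assumes "positive_op A" "continuous_on (op_spectrum A) f"
  shows "cfc A (\<lambda>z. c * f z) x = c *\<^sub>C cfc A f x"
    "continuous_on (op_spectrum A) g \<Longrightarrow> cfc A (\<lambda>z. f z + g z) = cfc A f + cfc A g"
    "continuous_on (op_spectrum A) g \<Longrightarrow> cfc A (\<lambda>z. f z * g z) = cfc A f o\<^sub>L cfc A g"
    "continuous_on (op_spectrum A) g \<Longrightarrow> (\<And>z. z \<in> op_spectrum A \<Longrightarrow> f z = g z) \<Longrightarrow> cfc A f = cfc A g"
  using functional_calculusD[OF positive_opD(1) cfc_is_functional_calculus[OF positive_opD(1)]] assms
  by blast+

lemma continuous_on_spectrum_powr:
  assumes A: "positive_op A" and p: "p > 0"
  shows "continuous_on (op_spectrum A) (\<lambda>z. complex_of_real (Re z powr p))"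
  using positive_opD(5)[OF A] p
  by (intro continuous_on_of_real continuous_on_powr' continuous_intros) auto

lemma positive_op_powr:
  assumes A: "positive_op A" and p: "p > 0"
  shows "positive_op (A powr\<^sub>o p)"
  unfolding positive_op_def op_powr_def
proof (intro conjI allI)
  note sa = positive_opD(1)[OF A]
  note fc = cfc_is_functional_calculus[OF sa] and cont = continuous_on_spectrum_powr[OF A p]
  show "selfadjoint (cfc A (\<lambda>z. complex_of_real (Re z powr p)))"
    by (rule functional_calculus_real_selfadjoint[OF sa fc cont])
  show "0 \<le> Re (cinner (cfc A (\<lambda>z. complex_of_real (Re z powr p)) x) x)" for x
    by (rule functional_calculus_nonneg_form[OF sa fc cont]) simp
qed

lemma op_powr_add:
  assumes A: "positive_op A" and "p > 0" "q > 0"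
  shows "A powr\<^sub>o (p + q) = A powr\<^sub>o p o\<^sub>L A powr\<^sub>o q"
  using cfc_homomorphism(3)[OF A continuous_on_spectrum_powr[OF A \<open>p > 0\<close>]
      continuous_on_spectrum_powr[OF A \<open>q > 0\<close>]]
  by (simp add: op_powr_def powr_add)

lemma op_powr_one:
  assumes A: "positive_op A"
  shows "A powr\<^sub>o 1 = A"
proof -
  have "A powr\<^sub>o 1 = cfc A (\<lambda>z. z)"
    unfolding op_powr_def
  proof (rule cfc_homomorphism(4)[OF A])
    fix z assume z: "z \<in> op_spectrum A"
    then show "complex_of_real (Re z powr 1) = z"
      using positive_opD(5)[OF A z] selfadjoint_spectrum_real[OF positive_opD(1)[OF A] z]
      by (simp add: complex_eq_iff)
  qed (use continuous_on_spectrum_powr[OF A, of 1] in \<open>auto intro: continuous_intros\<close>)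
  then show ?thesis
    using functional_calculus_one_id(2)[OF _ cfc_is_functional_calculus] positive_opD(1)[OF A] by metis
qed

text \<open>Convexity of the power function at s, obtained from Young's inequality for
  \<open>u powr p\<close> and \<open>s powr p\<close> with weights \<open>1 / p\<close> and
  \<open>1 - 1 / p\<close>.\<close>

lemma powr_above_tangent:
  fixes u s p :: real
  assumes "u \<ge> 0" "s > 0" "p \<ge> 1"
  shows "s powr p + p * s powr (p - 1) * (u - s) \<le> u powr p"
proof (cases "u = 0")
  case True
  have "p * (s powr (p - 1) * s) = p * s powr p"
    using assms(2) by (simp add: powr_diff)
  moreover have "s powr p \<le> p * s powr p"
    using mult_right_mono[OF assms(3), of "s powr p"] by simp
  ultimately have "s powr p \<le> p * s powr (p - 1) * s"
    by (simp only: mult.assoc)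
  then show ?thesis
    using True by simp
next
  case False
  have "p * (1 - 1 / p) = p - 1"
    using assms(3) by (simp add: field_simps)
  then have "u * s powr (p - 1) \<le> 1 / p * u powr p + (1 - 1 / p) * s powr p"
    using Youngs_inequality_0[of "1 / p" "1 - 1 / p" "u powr p" "s powr p"] assms False
    by (simp add: powr_powr)
  then have "p * (u * s powr (p - 1)) \<le> p * (1 / p * u powr p + (1 - 1 / p) * s powr p)"
    using assms(3) by (intro mult_left_mono) auto
  also have "\<dots> = u powr p + (p - 1) * s powr p"
    using assms(3) by (simp add: field_simps)
  finally show ?thesis
    using assms(2) by (simp add: powr_diff field_simps)
qed

text \<open>Jensen's inequality: the functional calculus turns the tangent line to \<open>t powr p\<close> at the
  mean \<open>s\<close> into an operator inequality.\<close>

lemma op_powr_jensen: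
  assumes A: "positive_op A" and q: "q > 0" and p: "p \<ge> 1" and x: "norm x = 1"
  shows "Re (cinner ((A powr\<^sub>o q) x) x) powr p \<le> Re (cinner ((A powr\<^sub>o (q * p)) x) x)"
proof -
  define s where "s = Re (cinner ((A powr\<^sub>o q) x) x)"
  have "s \<ge> 0"
    unfolding s_def by (rule positive_opD(3)[OF positive_op_powr[OF A q]])
  moreover have "0 \<le> Re (cinner ((A powr\<^sub>o (q * p)) x) x)"
    using q p by (intro positive_opD(3)[OF positive_op_powr[OF A]]) simp
  moreover have "s powr p \<le> Re (cinner ((A powr\<^sub>o (q * p)) x) x)" if s: "s > 0"
  proof -
    define k where "k = p * s powr (p - 1)"
    \<comment> \<open>The gap between the power and its tangent at s, both evaluated at
      \<open>Re z powr q\<close>; \<open>k\<close> is the slope.\<close>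
    define h where "h z = Re z powr (q * p) + ((- k) * Re z powr q + (k * s - s powr p))" for z
    let ?F = "\<lambda>z. complex_of_real (Re z powr (q * p))" and ?G = "\<lambda>z. complex_of_real (Re z powr q)"
      and ?c = "complex_of_real (k * s - s powr p)"
    have F: "continuous_on (op_spectrum A) ?F" and G: "continuous_on (op_spectrum A) ?G"
      using continuous_on_spectrum_powr[OF A] q p by simp_all
    have kG: "continuous_on (op_spectrum A) (\<lambda>z. of_real (- k) * ?G z)"
      by (intro continuous_on_mult continuous_on_const G)
    have kGc: "continuous_on (op_spectrum A) (\<lambda>z. of_real (- k) * ?G z + ?c)"
      by (intro continuous_on_add continuous_on_const kG)
    have h_eq: "(\<lambda>z. complex_of_real (h z)) = (\<lambda>z. ?F z + (of_real (- k) * ?G z + ?c))"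
      by (simp add: h_def fun_eq_iff)
    have "0 \<le> h z" if "z \<in> op_spectrum A" for z
      using powr_above_tangent[of "Re z powr q" s p] s p
      by (simp add: h_def k_def powr_powr algebra_simps)
    moreover have "continuous_on (op_spectrum A) (\<lambda>z. complex_of_real (h z))"
      unfolding h_eq by (intro continuous_on_add F kGc)
    ultimately have "0 \<le> Re (cinner (cfc A (\<lambda>z. complex_of_real (h z)) x) x)"
      using functional_calculus_nonneg_form[OF _ cfc_is_functional_calculus] positive_opD(1)[OF A]
      by blast
    also have "cfc A (\<lambda>z. complex_of_real (h z)) x
        = (A powr\<^sub>o (q * p)) x + (of_real (- k) *\<^sub>C (A powr\<^sub>o q) x + ?c *\<^sub>C x)"
      unfolding h_eq cfc_homomorphism(2)[OF A F kGc] cfc_homomorphism(2)[OF A kG continuous_on_const] blinfun.add_left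
        cfc_homomorphism(1)[OF A G] op_powr_def
        functional_calculus_const[OF positive_opD(1)[OF A] cfc_is_functional_calculus[OF positive_opD(1)[OF A]]] ..
    \<comment> \<open>As s is the mean of \<open>A powr\<^sub>o q\<close> at the unit vector x, the
      two terms with slope \<open>k\<close> cancel.\<close>
    also have "Re (cinner \<dots> x)
        = Re (cinner ((A powr\<^sub>o (q * p)) x) x) - k * s + (k * s - s powr p)"
      using x by (simp add: cinner.add_left cinner_scaleC_left cinner_self s_def scaleC.minus_left
          cinner.minus_left cinner.diff_left)
    finally show ?thesis by simp
  qed
  \<comment> \<open>The tangent argument covers s > 0; for s = 0 the left side is
    \<open>0 powr p\<close>, which is 0.\<close>
  ultimately show ?thesis
    unfolding s_def[symmetric] by (cases "s = 0") auto
qed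

lemma positive_op_adjoint_compose:
  assumes T: "T \<in> bounded_operators"
  shows "positive_op (hilbert_adjoint T o\<^sub>L T)"
proof -
  have "cinner (hilbert_adjoint T (T x)) y = cinner (T x) (T y)" for x y
    using cinner_hilbert_adjoint_right[OF T] by (metis cinner_commute)
  then show ?thesis
    using T by (simp add: positive_op_def selfadjoint_def flip: cinner_hilbert_adjoint_right[OF T])
qed

lemma positive_op_abs: "T \<in> bounded_operators \<Longrightarrow> positive_op (op_abs T)"
  unfolding op_abs_def by (intro positive_op_powr positive_op_adjoint_compose) auto

text \<open>Exponents are added twice: \<open>1 + 1\<close> for \<open>op_abs T\<close>, then
  \<open>1/2 + 1/2\<close> for the product of the adjoint with T.\<close>

lemma op_abs_powr_two:
  assumes T: "T \<in> bounded_operators"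
  shows "op_abs T powr\<^sub>o 2 = hilbert_adjoint T o\<^sub>L T"
proof -
  note pos = positive_op_adjoint_compose[OF T]
  have "op_abs T powr\<^sub>o (1 + 1) = op_abs T o\<^sub>L op_abs T"
    using op_powr_add[OF positive_op_abs[OF T], of 1 1] by (simp add: op_powr_one positive_op_abs T)
  also have "\<dots> = hilbert_adjoint T o\<^sub>L T"
    using op_powr_add[OF pos, of "1/2" "1/2"] by (simp add: op_abs_def op_powr_one pos)
  finally show ?thesis by simp
qed

text \<open>Jensen for \<open>op_abs T\<close> with inner exponent 2 and outer exponent r, as the
  form of \<open>op_abs T powr\<^sub>o 2\<close> is the squared norm of \<open>T x\<close>.\<close>

lemma norm_powr_le_op_abs_powr_form:
  assumes T: "T \<in> bounded_operators" and r: "r \<ge> 1" and x: "norm x = 1"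
  shows "(norm (T x))\<^sup>2 powr r \<le> Re (cinner ((op_abs T powr\<^sub>o (2 * r)) x) x)"
proof -
  have "Re (cinner ((op_abs T powr\<^sub>o 2) x) x) = (norm (T x))\<^sup>2"
    unfolding op_abs_powr_two[OF T] Re_cinner_commute[of _ x]
    by (simp flip: cinner_hilbert_adjoint_right[OF T])
  then show ?thesis
    using op_powr_jensen[OF positive_op_abs[OF T], of 2 r x] r x by simp
qed

section \<open>Estimates for the numerical radius\<close>

lemma cmod_form_le_norm:
  fixes A :: "'a::complex_hilbert_space \<Rightarrow>\<^sub>L 'a"
  assumes "norm x = 1"
  shows "cmod (cinner (A x) x) \<le> norm A"
  using order_trans[OF cmod_cinner_le[of "A x" x]] norm_blinfun[of A x] assms by simp

lemma Re_form_le_norm: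
  fixes A :: "'a::complex_hilbert_space \<Rightarrow>\<^sub>L 'a"
  assumes "norm x = 1"
  shows "Re (cinner (A x) x) \<le> norm A"
  using cmod_form_le_norm[OF assms, of A] complex_Re_le_cmod order_trans by blast

lemma bdd_above_numerical_range:
  fixes A :: "'a::complex_hilbert_space \<Rightarrow>\<^sub>L 'a"
  shows "bdd_above (insert 0 {cmod (cinner (A x) x) |x. norm x = 1})"
  by (rule bdd_aboveI[of _ "norm A"]) (auto simp: cmod_form_le_norm)

lemma numerical_radius_upper:
  fixes A :: "'a::complex_hilbert_space \<Rightarrow>\<^sub>L 'a"
  assumes "norm x = 1"
  shows "cmod (cinner (A x) x) \<le> numerical_radius A"
  unfolding numerical_radius_def
  by (rule cSup_upper[OF _ bdd_above_numerical_range]) (use assms in blast)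

lemma numerical_radius_nonneg: "0 \<le> numerical_radius A"
  unfolding numerical_radius_def by (rule cSup_upper[OF _ bdd_above_numerical_range]) simp

text \<open>\<open>0 \<le> c\<close> accounts for the inserted 0, which is all that remains of the
  set on the zero space.\<close>

lemma numerical_radius_least:
  fixes A :: "'a::complex_hilbert_space \<Rightarrow>\<^sub>L 'a"
  assumes "0 \<le> c" "\<And>x. norm x = 1 \<Longrightarrow> cmod (cinner (A x) x) \<le> c"
  shows "numerical_radius A \<le> c"
  unfolding numerical_radius_def by (rule cSup_least) (use assms in auto)

text \<open>Taking p-th roots before the supremum and powers afterwards moves a pointwise bound
  through the supremum.\<close>

lemma numerical_radius_powr_le:
  fixes A :: "'a::complex_hilbert_space \<Rightarrow>\<^sub>L 'a"
  assumes p: "p > 0" and c: "0 \<le> c"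
    and le: "\<And>x. norm x = 1 \<Longrightarrow> cmod (cinner (A x) x) powr p \<le> c"
  shows "numerical_radius A powr p \<le> c"
proof -
  have "numerical_radius A \<le> c powr (1 / p)"
  proof (rule numerical_radius_least)
    fix x :: 'a assume "norm x = 1"
    then have "(cmod (cinner (A x) x) powr p) powr (1 / p) \<le> c powr (1 / p)"
      using le p by (intro powr_mono2) auto
    then show "cmod (cinner (A x) x) \<le> c powr (1 / p)"
      using p by (simp add: powr_powr)
  qed simp
  then have "numerical_radius A powr p \<le> (c powr (1 / p)) powr p"
    using p numerical_radius_nonneg by (intro powr_mono2) auto
  then show ?thesis
    using p c by (simp add: powr_powr)
qed

theorem theorem2p14:
  fixes T S :: "'a::complex_hilbert_space \<Rightarrow>\<^sub>L 'a" and r l :: real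
  assumes "T \<in> bounded_operators" and "S \<in> bounded_operators"
    and "r \<ge> 1" and "l \<ge> 0"
  shows "numerical_radius (hilbert_adjoint T o\<^sub>L S) powr (2 * r)
    \<le> 1 / (2 * (l + 1)) * norm (op_abs T powr\<^sub>o (2 * r) + op_abs S powr\<^sub>o (2 * r))
          * numerical_radius (hilbert_adjoint T o\<^sub>L S) powr r
      + l / (4 * (l + 1)) * norm (op_abs T powr\<^sub>o (4 * r) + op_abs S powr\<^sub>o (4 * r))
      + l / (2 * (l + 1))
          * numerical_radius (op_abs S powr\<^sub>o (2 * r) o\<^sub>L op_abs T powr\<^sub>o (2 * r))"
proof -
  note T = assms(1) and S = assms(2) and r = assms(3) and l = assms(4)
  define P where "P = op_abs T powr\<^sub>o (2 * r)"
  define Q where "Q = op_abs S powr\<^sub>o (2 * r)"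
  define w where "w = numerical_radius (hilbert_adjoint T o\<^sub>L S)"
  have "positive_op P" "positive_op Q"
    unfolding P_def Q_def using r by (auto intro!: positive_op_powr positive_op_abs T S)
  note P = positive_opD[OF this(1)] and Q = positive_opD[OF this(2)]
  have PP: "op_abs T powr\<^sub>o (4 * r) = P o\<^sub>L P" and QQ: "op_abs S powr\<^sub>o (4 * r) = Q o\<^sub>L Q"
    using op_powr_add[OF positive_op_abs[OF T], of "2 * r" "2 * r"]
      op_powr_add[OF positive_op_abs[OF S], of "2 * r" "2 * r"] r
    by (simp_all add: P_def Q_def)
  \<comment> \<open>\<open>X\<close> is the bound from the arithmetic-geometric mean and
    \<open>Y\<close> the one from Buzano; the claimed right-hand side is
    \<open>(X + l * Y) / (l + 1)\<close>.\<close>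
  define X where "X = norm (P + Q) / 2 * w powr r"
  define Y where "Y = norm ((P o\<^sub>L P) + (Q o\<^sub>L Q)) / 4 + numerical_radius (Q o\<^sub>L P) / 2"
  have scale: "X / k + l / k * Y = 1 / (2 * k) * norm (P + Q) * w powr r
      + l / (4 * k) * norm ((P o\<^sub>L P) + (Q o\<^sub>L Q)) + l / (2 * k) * numerical_radius (Q o\<^sub>L P)" for k
    by (simp add: X_def Y_def distrib_left)
  have "w powr (2 * r) \<le> X / (l + 1) + l / (l + 1) * Y"
    unfolding w_def
  proof (rule numerical_radius_powr_le)
    show "0 \<le> X / (l + 1) + l / (l + 1) * Y"
      using l numerical_radius_nonneg[of "Q o\<^sub>L P"] by (simp add: X_def Y_def)
    fix x :: 'a assume x: "norm x = 1"
    define a where "a = cmod (cinner ((hilbert_adjoint T o\<^sub>L S) x) x)"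
    define \<alpha> where "\<alpha> = Re (cinner (P x) x)"
    define \<beta> where "\<beta> = Re (cinner (Q x) x)"
    have nonneg: "0 \<le> a" "0 \<le> \<alpha>" "0 \<le> \<beta>"
      using P(3) Q(3) by (auto simp: a_def \<alpha>_def \<beta>_def)
    have "a = cmod (cinner (T x) (S x))"
      unfolding a_def cinner_hilbert_adjoint_right[OF T]
      by (metis blinfun_apply_blinfun_compose cinner_commute complex_mod_cnj)
    then have "a \<le> norm (T x) * norm (S x)"
      by (simp add: cmod_cinner_le)
    then have "a\<^sup>2 \<le> (norm (T x))\<^sup>2 * (norm (S x))\<^sup>2"
      using nonneg by (metis power_mono power_mult_distrib)
    then have "a\<^sup>2 powr r \<le> (norm (T x))\<^sup>2 powr r * (norm (S x))\<^sup>2 powr r"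
      using r by (auto simp flip: powr_mult intro!: powr_mono2)
    also have "\<dots> \<le> \<alpha> * \<beta>"
      unfolding \<alpha>_def \<beta>_def P_def Q_def
      using norm_powr_le_op_abs_powr_form[OF T r x] norm_powr_le_op_abs_powr_form[OF S r x]
      by (intro mult_mono) (auto intro: order_trans[OF powr_ge_zero])
    finally have a_le: "(a powr r)\<^sup>2 \<le> \<alpha> * \<beta>"
      by (simp add: power2_eq_square powr_mult)
    \<comment> \<open>One factor \<open>a powr r\<close> is at most half of \<alpha> + \<beta>, the
      other is bounded by \<open>w powr r\<close>.\<close>
    have "(a powr r)\<^sup>2 \<le> X"
    proof -
      have "4 * (\<alpha> * \<beta>) \<le> (\<alpha> + \<beta>)\<^sup>2"
        using zero_le_power2[of "\<alpha> - \<beta>"] by (simp add: power2_eq_square algebra_simps)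
      then have "(2 * a powr r)\<^sup>2 \<le> (\<alpha> + \<beta>)\<^sup>2"
        using a_le by (simp add: power_mult_distrib)
      then have "2 * a powr r \<le> \<alpha> + \<beta>"
        by (rule power2_le_imp_le) (use nonneg in simp)
      also have "\<dots> \<le> norm (P + Q)"
        using Re_form_le_norm[OF x, of "P + Q"]
        by (simp add: \<alpha>_def \<beta>_def blinfun.add_left cinner.add_left)
      finally have "a powr r \<le> norm (P + Q) / 2" by simp
      moreover have "a powr r \<le> w powr r"
        using numerical_radius_upper[OF x, of "hilbert_adjoint T o\<^sub>L S"] r nonneg
        by (intro powr_mono2) (auto simp: a_def w_def)
      ultimately show ?thesis
        unfolding X_def power2_eq_square by (intro mult_mono) auto
    qed
    moreover have "(a powr r)\<^sup>2 \<le> Y"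
    proof -
      have "\<alpha> * \<beta> \<le> cmod (cinner (P x) x) * cmod (cinner x (Q x))"
        unfolding \<alpha>_def \<beta>_def Re_cinner_commute[of "Q x"]
        using Q(3)[of x] by (intro mult_mono complex_Re_le_cmod) (auto simp: Re_cinner_commute[of x])
      \<comment> \<open>Buzano for the vectors \<open>P x\<close> and \<open>Q x\<close> with unit
        vector x. Self-adjointness of \<open>Q\<close> turns the mixed inner product into the form
        of \<open>Q o\<^sub>L P\<close>, which fixes the order of the product in the last
        term.\<close>
      also have "\<dots> \<le> (norm (P x) * norm (Q x) + cmod (cinner (P x) (Q x))) / 2"
        by (rule buzano[OF x])
      also have "cmod (cinner (P x) (Q x)) \<le> numerical_radius (Q o\<^sub>L P)"
        using numerical_radius_upper[OF x, of "Q o\<^sub>L P"] by (simp add: Q(4))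
      also have "norm (P x) * norm (Q x) \<le> ((norm (P x))\<^sup>2 + (norm (Q x))\<^sup>2) / 2"
        using sum_squares_bound[of "norm (P x)" "norm (Q x)"] by simp
      \<comment> \<open>By self-adjointness this sum is the form of the sum of the squares of
        \<open>P\<close> and \<open>Q\<close>, which are the powers with exponent 4 r.\<close>
      also have "(norm (P x))\<^sup>2 + (norm (Q x))\<^sup>2 \<le> norm ((P o\<^sub>L P) + (Q o\<^sub>L Q))"
        using Re_form_le_norm[OF x, of "(P o\<^sub>L P) + (Q o\<^sub>L Q)"]
        by (simp add: blinfun.add_left cinner.add_left P(4)[of "P x"] Q(4)[of "Q x"])
      finally show ?thesis
        using a_le by (simp add: Y_def)
    qed
    ultimately have "(a powr r)\<^sup>2 + l * (a powr r)\<^sup>2 \<le> X + l * Y"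
      using l by (intro add_mono mult_left_mono)
    then have "(a powr r)\<^sup>2 \<le> (X + l * Y) / (l + 1)"
      using l by (simp add: pos_le_divide_eq algebra_simps)
    moreover have "a powr (2 * r) = (a powr r)\<^sup>2"
      by (simp add: power2_eq_square flip: powr_add)
    ultimately show "cmod (cinner ((hilbert_adjoint T o\<^sub>L S) x) x) powr (2 * r)
        \<le> X / (l + 1) + l / (l + 1) * Y"
      by (simp add: a_def add_divide_distrib)
  qed (use r in simp)
  also have "\<dots> = 1 / (2 * (l + 1)) * norm (P + Q) * w powr r
      + l / (4 * (l + 1)) * norm ((P o\<^sub>L P) + (Q o\<^sub>L Q)) + l / (2 * (l + 1)) * numerical_radius (Q o\<^sub>L P)"
    by (rule scale)
  finally show ?thesis
    unfolding PP QQ by (simp only: P_def Q_def w_def)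
qed

end
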